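(* Let $\nu,\alpha,\beta\in\mathbb{R}$ with $\alpha>-1-2\nu$ and $\beta>-1$. Let $f(z)=z^{\nu}F(z)$ belong to the class $\mathcal{A}$ (defined in the context), let $\lambda_n>0$, $n=1,2,\dots$, be the positive zeros of $F$, and suppose that $$\int_0^1 f(\lambda_n t)f(\lambda_m t)\,t^{\alpha}(1-t)^{\beta}\,dt=0\qquad\text{whenever } n\neq m .$$ Then the following integral equation holds: $$a\int_0^z u^{\nu+\alpha+2}(z-u)^{\beta}f(u)\,du=(az^2+2)\int_0^z u^{\nu+\alpha}(z-u)^{\beta}f(u)\,du+z^{\nu+\alpha+\beta+1}f(z)\,A,$$ where $a=F''(0)$ and $A=-2B(2\nu+\alpha+1,\beta+1)$, with $B$ the Euler Beta function.
   Context: Class $\mathcal{A}$: let $\nu,\alpha\in\mathbb{R}$ with $2\nu+\alpha>-1$. A function $f(z)=z^{\nu}F(z)$ is said to belong to the class $\mathcal{A}$ if $F$ is an even entire function with $F(0)=1$, of order less than two or of order two and minimal type, whose zeros are real and situated symmetrically about the origin, i.e. they are $\pm\lambda_n$ with $\lambda_n>0$, $n=1,2,\dots$, and $\sum_n\lambda_n^{-2}<\infty$. Conventions: $\int_0^z$ is taken along the segment $u=zt$, $0\le t\le 1$, with powers interpreted consistently, so that $u^{s}=z^{s}t^{s}$ and $(z-u)^{\beta}=z^{\beta}(1-t)^{\beta}$; $z^{\nu}$ denotes a fixed branch of the power. *)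

theory Defs
  imports "HOL-Complex_Analysis.Complex_Analysis"
begin

definition max_modulus :: "(complex \<Rightarrow> complex) \<Rightarrow> real \<Rightarrow> real" where
  "max_modulus F r = (SUP z\<in>sphere 0 r. norm (F z))"

definition growth_order :: "(complex \<Rightarrow> complex) \<Rightarrow> ereal" where
  "growth_order F = Limsup at_top (\<lambda>r::real. ereal (ln (ln (max_modulus F r)) / ln r))"

definition growth_type :: "real \<Rightarrow> (complex \<Rightarrow> complex) \<Rightarrow> ereal" where
  "growth_type \<rho> F = Limsup at_top (\<lambda>r::real. ereal (ln (max_modulus F r) / r powr \<rho>))"

text \<open>
  A branch of the logarithm on the punctured plane that is compatible with positive scaling.
  The choice on each ray from the origin is arbitrary, so no particular branch cut is imposed,
  and the value at 0 is irrelevant.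
\<close>

definition log_branch :: "(complex \<Rightarrow> complex) \<Rightarrow> bool" where
  "log_branch L \<longleftrightarrow>
     (\<forall>z. z \<noteq> 0 \<longrightarrow> exp (L z) = z) \<and>
     (\<forall>z t. z \<noteq> 0 \<longrightarrow> 0 < t \<longrightarrow> L (of_real t * z) = of_real (ln t) + L z)"

definition branch_pow :: "(complex \<Rightarrow> complex) \<Rightarrow> real \<Rightarrow> complex \<Rightarrow> complex" where
  "branch_pow L s z = exp (of_real s * L z)"

lemma log_branch_Ln: "log_branch Ln"
  by (auto simp: log_branch_def Ln_times_of_real Ln_of_real)

lemma branch_pow_Ln: "z \<noteq> 0 \<Longrightarrow> branch_pow Ln s z = z powr of_real s"
  by (simp add: branch_pow_def powr_def)

lemma branch_pow_scale:
  assumes "log_branch L" "z \<noteq> 0" "0 < t"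
  shows "branch_pow L s (of_real t * z) = of_real (t powr s) * branch_pow L s z"
proof -
  have "branch_pow L s (of_real t * z) = exp (of_real (s * ln t) + of_real s * L z)"
    using assms by (simp add: branch_pow_def log_branch_def distrib_left)
  also have "\<dots> = of_real (t powr s) * branch_pow L s z"
    using assms(3) by (simp only: exp_add exp_of_real) (simp add: branch_pow_def powr_def)
  finally show ?thesis .
qed

text \<open>
  \<open>class_A L \<nu> \<alpha> f F lam\<close>: the function \<open>f\<close>, with \<open>f z = z\<^sup>\<nu> F z\<close> for the branch given by \<open>L\<close>,
  belongs to the class, and \<open>lam\<close> enumerates the positive zeros of \<open>F\<close>, each zero being listed
  as often as its multiplicity.  (Summability makes the cardinality below that of a finite set.)
\<close>

definition class_A ::
    "(complex \<Rightarrow> complex) \<Rightarrow> real \<Rightarrow> real \<Rightarrow> (complex \<Rightarrow> complex) \<Rightarrow> (complex \<Rightarrow> complex) \<Rightarrow>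
     (nat \<Rightarrow> real) \<Rightarrow> bool" where
  "class_A L \<nu> \<alpha> f F lam \<longleftrightarrow>
     2 * \<nu> + \<alpha> > -1 \<and>
     (\<forall>z. z \<noteq> 0 \<longrightarrow> f z = branch_pow L \<nu> z * F z) \<and>
     F holomorphic_on UNIV \<and>
     (\<forall>z. F (- z) = F z) \<and>
     F 0 = 1 \<and>
     (growth_order F < 2 \<or> growth_order F = 2 \<and> growth_type 2 F = 0) \<and>
     (\<forall>n. lam n > 0) \<and>
     {z. F z = 0} = (\<Union>n. {of_real (lam n), - of_real (lam n)}) \<and>
     (\<forall>n. zorder F (of_real (lam n)) = int (card {m. lam m = lam n})) \<and>
     summable (\<lambda>n. 1 / (lam n)\<^sup>2)"

end

theory Submission
  imports Defs
begin

text \<open>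
  Write \<open>\<mu> = 2 * \<nu> + \<alpha>\<close> and let \<open>M\<close> be the measure with density \<open>t powr \<mu> * (1 - t) powr \<beta>\<close> on the unit
  interval; its mass is \<open>B = Beta (\<mu> + 1) (\<beta> + 1)\<close>. Parametrise the segment by \<open>u = t z\<close> and cancel the
  powers of \<open>z\<close>. With \<open>I(z) = \<integral> F(t z) \<partial>M\<close> and \<open>J(z) = \<integral> t\<^sup>2 F(t z) \<partial>M\<close>, the integral equation says that the
  even entire function \<open>K(z) = (a z\<^sup>2 + 2) I(z) - a z\<^sup>2 J(z)\<close> equals \<open>2 B F(z)\<close>, and the hypothesis says
  that \<open>F(\<lambda>\<^sub>n t)\<close> and \<open>F(\<lambda>\<^sub>m t)\<close> are orthogonal with respect to \<open>M\<close>.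

  The engine is a rigidity principle going back to Hardy (\<open>multiple_of_F_if_vanishes_at_zeros\<close>): an even
  entire function \<open>N\<close> that vanishes at every zero of \<open>F\<close> and satisfies
  \<open>|N(z)| \<le> C (1 + |z|\<^sup>2) \<integral> |F(t z)| \<partial>M\<close> is a constant multiple of \<open>F\<close>. It is used twice in
  \<open>dilation_equation\<close>. By orthogonality it applies to \<open>N(z) = (z\<^sup>2 - \<lambda>\<^sub>n\<^sup>2) \<integral> F(t z) F(t \<lambda>\<^sub>n) \<partial>M\<close>; comparing the
  coefficients of \<open>z\<^sup>2\<close> in \<open>N = N(0) F\<close> gives \<open>(a \<lambda>\<^sub>n\<^sup>2 + 2) I(\<lambda>\<^sub>n) = a \<lambda>\<^sub>n\<^sup>2 J(\<lambda>\<^sub>n)\<close>, that is, \<open>K(\<lambda>\<^sub>n) = 0\<close>. So it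
  applies to \<open>K\<close> as well, and \<open>K = K(0) F = 2 B F\<close>.

  To prove the principle, note first that orthogonality forces the \<open>\<lambda>\<^sub>n\<close> to be distinct, because \<open>F\<close> is
  real on the real axis; hence the zeros of \<open>F\<close> are simple and \<open>Q = N / F\<close> is entire. Put \<open>w = z\<^sup>2\<close> and
  \<open>c\<^sub>m = \<lambda>\<^sub>m\<^sup>2\<close>, so that \<open>F\<close> is the product of the factors \<open>1 - w / c\<^sub>m\<close>. If \<open>Re w \<le> 0\<close>, passing from \<open>z\<close> to \<open>t z\<close>
  does not increase the modulus of any factor, so \<open>Q(z) = O(|z|\<^sup>2)\<close>. If \<open>Re w \<ge> 0\<close> and \<open>|w| = R\<close>, it increases the
  modulus of a factor with \<open>c\<^sub>m \<le> 2 R\<close> by at most \<open>|R + w| / |R - w|\<close>, and that of any other factor by at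
  most \<open>exp (4 Re w / c\<^sub>m)\<close>. The function \<open>(R - w) / (R + w)\<close> has modulus 1 on the imaginary axis, so the
  maximum principle on the half-disc \<open>|w| < R\<close>, \<open>Re w > 0\<close>, applied to \<open>Q / (1 + w)\<close> times a power of that
  function and an exponential, carries the bound \<open>O(|z|\<^sup>2)\<close> from the boundary to the interior, up to a
  factor which tends to 1 as \<open>R\<close> grows (\<open>half_disc_bound\<close>).
  Finally \<open>Q\<close> is even and \<open>o(|z|\<^sup>2)\<close> along the imaginary axis, hence constant.

  That \<open>F\<close> is its canonical product (\<open>hadamard_even_minimal_type2\<close>) follows in the same way: the
  inequalities with \<open>t = 0\<close> bound the product from below, so the zero-free quotient of \<open>F\<close> by the product
  is again of minimal type of order two, and its logarithm is constant by the Borel-Caratheodory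
  inequality.
\<close>

section \<open>Dilations of a canonical product\<close>

lemma cmod_one_minus_scaled_le:
  fixes w :: complex
  assumes "Re w \<le> 0" "0 \<le> s" "s \<le> 1"
  shows "cmod (1 - of_real s * w) \<le> cmod (1 - w)"
proof -
  have "s * (- Re w) \<le> 1 * (- Re w)" by (rule mult_right_mono) (use assms in auto)
  moreover have "(s * Im w)\<^sup>2 \<le> (Im w)\<^sup>2"
    using assms by (intro abs_le_square_iff[THEN iffD1]) (simp add: abs_mult mult_left_le_one_le)
  moreover have "0 \<le> s * (- Re w)" using assms by (intro mult_nonneg_nonneg) auto
  moreover have "(1 - s * Re w)\<^sup>2 \<le> (1 - Re w)\<^sup>2"
    using calculation by (intro power_mono) auto
  ultimately have "(1 - s * Re w)\<^sup>2 + (s * Im w)\<^sup>2 \<le> (1 - Re w)\<^sup>2 + (Im w)\<^sup>2"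
    by linarith
  then show ?thesis
    by (simp add: cmod_def)
qed

text \<open>
  The ratio of the two factors is at most the reciprocal modulus of the Blaschke-type factor
  \<open>(R - w) / (R + w)\<close>. Multiplying out rather than dividing keeps the inequality meaningful at \<open>w = R\<close>,
  where a factor may vanish.
\<close>
lemma cmod_one_minus_scaled_le_Blaschke:
  fixes w :: complex
  assumes R: "cmod w = R" "R > 0" and "Re w \<ge> 0" "0 \<le> s" "s \<le> 1" "c > 0"
  shows "cmod (1 - of_real s * (w / of_real c)) * cmod (of_real R - w)
    \<le> cmod (1 - w / of_real c) * cmod (of_real R + w)"
proof (rule power2_le_imp_le)
  define x y where "x = Re w" and "y = Im w"
  have xy: "x\<^sup>2 + y\<^sup>2 = R\<^sup>2" using R(1) unfolding x_def y_def cmod_power2[symmetric] by simp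
  have x: "0 \<le> x" "x \<le> R" using assms abs_Re_le_cmod[of w] by (auto simp: x_def)
  have e1: "(cmod (of_real R - w))\<^sup>2 = 2 * R * (R - x)" "(cmod (of_real R + w))\<^sup>2 = 2 * R * (R + x)"
    using xy unfolding cmod_power2 x_def[symmetric] y_def[symmetric] 
    by (auto simp: power2_eq_square algebra_simps x_def y_def)
  have e2: "(cmod (1 - of_real s * (w / of_real c)))\<^sup>2 = ((c - s*x)\<^sup>2 + s\<^sup>2*y\<^sup>2)/c\<^sup>2"
       "(cmod (1 - w / of_real c))\<^sup>2 = ((c - x)\<^sup>2 + y\<^sup>2)/c\<^sup>2"
    using \<open>c > 0\<close> unfolding cmod_power2 by (auto simp: power2_eq_square field_simps x_def y_def)
  \<comment> \<open>The left side is convex in \<open>s\<close>, so it lies below the chord between \<open>s = 0\<close> and \<open>s = 1\<close>.\<close>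
  have conv: "(c - s*x)\<^sup>2 + s\<^sup>2*y\<^sup>2 \<le> (1-s) * c\<^sup>2 + s * ((c - x)\<^sup>2 + y\<^sup>2)"
  proof -
    have "(1-s) * c\<^sup>2 + s * ((c - x)\<^sup>2 + y\<^sup>2) - ((c - s*x)\<^sup>2 + s\<^sup>2*y\<^sup>2) = s * (1 - s) * (x\<^sup>2+y\<^sup>2)"
      by (simp add: power2_eq_square algebra_simps)
    moreover have "\<dots> \<ge> 0" using assms by (intro mult_nonneg_nonneg) auto
    ultimately show ?thesis by linarith
  qed
  \<comment> \<open>The endpoint \<open>s = 0\<close>: the difference of the two sides is a sum of nonnegative terms.\<close>
  have zero: "c\<^sup>2 * (R - x) \<le> ((c - x)\<^sup>2 + y\<^sup>2) * (R + x)"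
  proof -
    have "((c - x)\<^sup>2 + y\<^sup>2) * (R + x) - c\<^sup>2 * (R - x) = (c\<^sup>2 - 2*c*x + (x\<^sup>2 + y\<^sup>2)) * (R + x) - c\<^sup>2 * (R - x)"
      by (simp add: power2_eq_square algebra_simps)
    also have "\<dots> = 2 * x * (c - R/2 - x/2)\<^sup>2 + (R + x) * (R - x) * (R + x/2)"
      unfolding xy by (simp add: power2_eq_square algebra_simps)
    finally have "((c - x)\<^sup>2 + y\<^sup>2) * (R + x) - c\<^sup>2 * (R - x) = \<dots>" .
    moreover have "\<dots> \<ge> 0" using x by (intro add_nonneg_nonneg mult_nonneg_nonneg divide_nonneg_nonneg) auto
    ultimately show ?thesis by linarith
  qed
  have "((c - s*x)\<^sup>2 + s\<^sup>2*y\<^sup>2) * (R - x) \<le> ((1-s) * c\<^sup>2 + s * ((c - x)\<^sup>2 + y\<^sup>2)) * (R - x)"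
    using conv x by (intro mult_right_mono) auto
  also have "\<dots> = (1-s) * (c\<^sup>2 * (R-x)) + s * (((c - x)\<^sup>2 + y\<^sup>2) * (R - x))"
    by (simp add: algebra_simps)
  also have "\<dots> \<le> (1-s) * (((c - x)\<^sup>2 + y\<^sup>2) * (R + x)) + s * (((c - x)\<^sup>2 + y\<^sup>2) * (R + x))"
    using zero assms x by (intro add_mono mult_left_mono) auto
  finally have "((c - s*x)\<^sup>2 + s\<^sup>2*y\<^sup>2) * (R - x) \<le> ((c - x)\<^sup>2 + y\<^sup>2) * (R + x)"
    by (simp add: algebra_simps)
  then have "((c - s*x)\<^sup>2 + s\<^sup>2*y\<^sup>2) * (R - x) * (2 * R / c\<^sup>2) \<le> ((c - x)\<^sup>2 + y\<^sup>2) * (R + x) * (2 * R / c\<^sup>2)"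
    using \<open>R > 0\<close> by (intro mult_right_mono) auto
  then show "(cmod (1 - of_real s * (w / of_real c)) * cmod (of_real R - w))\<^sup>2
    \<le> (cmod (1 - w / of_real c) * cmod (of_real R + w))\<^sup>2"
    unfolding power_mult_distrib e1 e2 by (simp add: field_simps)
qed auto

lemma cmod_one_minus_scaled_le_exp:
  fixes w :: complex
  assumes "cmod w \<le> 1/2" "Re w \<ge> 0" "0 \<le> s" "s \<le> 1"
  shows "cmod (1 - of_real s * w) \<le> cmod (1 - w) * exp (4 * Re w)"
proof (rule power2_le_imp_le)
  define x y where "x = Re w" and "y = Im w"
  have half: "1/2 \<le> cmod (1 - w)"
    using norm_triangle_ineq2[of 1 w] assms(1) by simp
  then have quarter: "1/4 \<le> (cmod (1 - w))\<^sup>2"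
    using power_mono[OF half, of 2] by (simp add: power2_eq_square)
  have e: "(cmod (1 - of_real s * w))\<^sup>2 = (cmod (1 - w))\<^sup>2 + 2*(1-s)*x - (1-s\<^sup>2)*(x\<^sup>2+y\<^sup>2)"
    unfolding cmod_power2 by (simp add: x_def y_def power2_eq_square algebra_simps)
  have "s\<^sup>2 \<le> 1" using assms by (simp add: power_le_one)
  then have "0 \<le> (1-s\<^sup>2)*(x\<^sup>2+y\<^sup>2)" by simp
  moreover have "(1-s)*x \<le> 1*x" using assms by (intro mult_right_mono) (auto simp: x_def)
  ultimately have "(cmod (1 - of_real s * w))\<^sup>2 \<le> (cmod (1 - w))\<^sup>2 + 2*x"
    using e by linarith
  also have "2*x \<le> (cmod (1 - w))\<^sup>2 * (8*x)"
    using mult_right_mono[OF quarter, of "8*x"] assms by (simp add: x_def)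
  also have "(cmod (1 - w))\<^sup>2 + (cmod (1 - w))\<^sup>2 * (8*x) = (cmod (1 - w))\<^sup>2 * (1 + 8*x)"
    by (simp add: algebra_simps)
  also have "\<dots> \<le> (cmod (1 - w))\<^sup>2 * exp (8*x)"
    by (intro mult_left_mono exp_ge_add_one_self) auto
  finally show "(cmod (1 - of_real s * w))\<^sup>2 \<le> (cmod (1 - w) * exp (4 * Re w))\<^sup>2"
    by (simp add: power_mult_distrib x_def flip: exp_double)
qed auto

text \<open>
  This one quantity controls both parts of the product on the circle \<open>|w| = R\<close>: up to the factor \<open>2 R\<close>, the
  number of zeros with \<open>c\<^sub>m \<le> 2 R\<close>, and the sum of \<open>1 / c\<^sub>m\<close> over the remaining ones.
\<close>
definition tail_weight :: "(nat \<Rightarrow> real) \<Rightarrow> real \<Rightarrow> real" where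
  "tail_weight c R = (\<Sum>m. min (1 / c m) (1 / (2 * R)))"

context
  fixes c :: "nat \<Rightarrow> real"
  assumes c_pos: "\<And>m. c m > 0" and summable_c: "summable (\<lambda>m. 1 / c m)"
begin

lemma summable_tail_weight:
  assumes "R > 0" shows "summable (\<lambda>m. min (1 / c m) (1 / (2 * R)))"
  by (rule summable_comparison_test'[OF summable_c, of 0]) (use c_pos assms in \<open>auto simp: less_imp_le\<close>)

lemma finite_below: "finite {m. c m \<le> r}"
proof -
  have "(\<lambda>m. 1 / c m) \<longlonglongrightarrow> 0" by (rule summable_LIMSEQ_zero[OF summable_c])
  then have "\<forall>\<^sub>F m in sequentially. 1 / c m < 1 / (\<bar>r\<bar> + 1)"
    by (rule order_tendstoD) auto
  then obtain N where N: "\<And>m. m \<ge> N \<Longrightarrow> 1 / c m < 1 / (\<bar>r\<bar> + 1)"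
    by (auto simp: eventually_sequentially)
  have "m < N" if "c m \<le> r" for m
  proof (rule ccontr)
    assume "\<not> m < N"
    then have "1 / c m < 1 / (\<bar>r\<bar> + 1)" using N by auto
    then have "\<bar>r\<bar> + 1 < c m" using c_pos[of m] by (simp add: field_simps)
    then show False using that by linarith
  qed
  then show ?thesis by (auto intro: finite_subset[of _ "{..<N}"])
qed

lemma tail_weight_tendsto_0: "(tail_weight c \<longlongrightarrow> 0) at_top"
proof -
  have "((\<lambda>R. \<Sum>m. min (1 / c m) (1 / (2 * R))) \<longlongrightarrow> (\<Sum>m. 0)) at_top"
  proof (rule conjunct2[OF conjunct2[OF tannerys_theorem]])
    fix k
    have *: "((\<lambda>R::real. 1 / (2 * R)) \<longlongrightarrow> 0) at_top" by real_asymp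
    show "((\<lambda>R. min (1 / c k) (1 / (2 * R))) \<longlongrightarrow> 0) at_top"
      by (rule tendsto_sandwich[OF _ _ tendsto_const *])
         (auto intro!: eventually_mono[OF eventually_gt_at_top[of 0]] simp: c_pos less_imp_le)
  next
    show "\<forall>\<^sub>F (k, R) in sequentially \<times>\<^sub>F at_top. norm (min (1 / c k) (1 / (2 * R))) \<le> 1 / c k"
      unfolding eventually_prod_filter
      by (rule exI[of _ "\<lambda>_. True"], rule exI[of _ "\<lambda>R. R > 0"])
         (auto simp: c_pos less_imp_le eventually_gt_at_top)
  qed (use summable_c in auto)
  then show ?thesis by (simp add: tail_weight_def[abs_def])
qed

lemma tail_weight_nonneg: "R > 0 \<Longrightarrow> 0 \<le> tail_weight c R"
  unfolding tail_weight_def by (intro suminf_nonneg summable_tail_weight) (auto simp: c_pos less_imp_le)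

lemma card_below_le_tail_weight:
  assumes "R > 0" shows "real (card {m. c m \<le> 2 * R}) \<le> 2 * R * tail_weight c R"
proof -
  have "(\<Sum>m\<in>{m. c m \<le> 2 * R}. min (1 / c m) (1 / (2 * R))) \<le> tail_weight c R"
    unfolding tail_weight_def
    by (rule sum_le_suminf[OF summable_tail_weight[OF assms] finite_below]) (use c_pos assms in \<open>auto simp: less_imp_le\<close>)
  also have "(\<Sum>m\<in>{m. c m \<le> 2 * R}. min (1 / c m) (1 / (2 * R))) = (\<Sum>m\<in>{m. c m \<le> 2 * R}. 1 / (2 * R))"
    by (rule sum.cong) (use c_pos assms in \<open>auto simp: min_def field_simps\<close>)
  finally show ?thesis using assms by (simp add: field_simps)
qed

lemma sum_above_le_tail_weight:
  assumes "R > 0" shows "(\<Sum>m<M. if c m \<le> 2 * R then 0 else 1 / c m) \<le> tail_weight c R"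
proof -
  have "(\<Sum>m<M. if c m \<le> 2 * R then 0 else 1 / c m) \<le> (\<Sum>m<M. min (1 / c m) (1 / (2 * R)))"
    by (rule sum_mono) (use c_pos assms in \<open>auto simp: min_def field_simps less_imp_le\<close>)
  also have "\<dots> \<le> tail_weight c R" unfolding tail_weight_def
    by (rule sum_le_suminf[OF summable_tail_weight[OF assms]]) (use c_pos assms in \<open>auto simp: less_imp_le\<close>)
  finally show ?thesis .
qed

text \<open>
  The canonical product enters only as a pointwise limit of its partial products, since all the
  inequalities pass to the limit factor by factor.
\<close>
context
  fixes G :: "complex \<Rightarrow> complex"
  assumes G: "\<And>w. (\<lambda>M. \<Prod>m<M. 1 - w / of_real (c m)) \<longlonglongrightarrow> G w"
begin

lemma canonical_product_0: "G 0 = 1"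
  using G[of 0] by (simp add: LIMSEQ_const_iff)

lemma canonical_product_dilation_left:
  assumes "Re w \<le> 0" "0 \<le> s" "s \<le> 1"
  shows "cmod (G (of_real s * w)) \<le> cmod (G w)"
proof (rule LIMSEQ_le[OF tendsto_norm[OF G] tendsto_norm[OF G]])
  have "cmod (1 - of_real s * w / of_real (c m)) \<le> cmod (1 - w / of_real (c m))" for m
    using cmod_one_minus_scaled_le[of "w / of_real (c m)" s] assms c_pos[of m]
    by (auto simp: divide_nonpos_pos)
  then show "\<exists>N. \<forall>n\<ge>N. cmod (\<Prod>m<n. 1 - of_real s * w / of_real (c m)) \<le> cmod (\<Prod>m<n. 1 - w / of_real (c m))"
    unfolding prod_norm[symmetric] by (auto intro!: prod_mono)
qed

text \<open>
  The case \<open>s = 0\<close> is a lower bound for the modulus of the product on the circle \<open>|w| = R\<close>. It stays valid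
  at a zero of the product, where the left-hand side vanishes too.
\<close>
lemma canonical_product_dilation_right:
  assumes "Re w \<ge> 0" "cmod w = R" "R > 0" "0 \<le> s" "s \<le> 1"
  defines "n \<equiv> card {m. c m \<le> 2 * R}"
  shows "cmod (G (of_real s * w)) * cmod (of_real R - w) ^ n
    \<le> cmod (G w) * cmod (of_real R + w) ^ n * exp (4 * tail_weight c R * Re w)"
proof (rule LIMSEQ_le)
  show "(\<lambda>M. cmod (\<Prod>m<M. 1 - of_real s * w / of_real (c m)) * cmod (of_real R - w) ^ n)
          \<longlonglongrightarrow> cmod (G (of_real s * w)) * cmod (of_real R - w) ^ n"
    by (intro tendsto_intros G)
  show "(\<lambda>M. cmod (\<Prod>m<M. 1 - w / of_real (c m)) * cmod (of_real R + w) ^ n * exp (4 * tail_weight c R * Re w))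
          \<longlonglongrightarrow> cmod (G w) * cmod (of_real R + w) ^ n * exp (4 * tail_weight c R * Re w)"
    by (intro tendsto_intros G)
  define A where "A = {m. c m \<le> 2 * R}"
  have finA: "finite A" unfolding A_def by (rule finite_below)
  then obtain N where N: "A \<subseteq> {..<N}" using finite_nat_iff_bounded by auto
  \<comment> \<open>The correction terms of the single factors; their products over \<open>m < M\<close> are those of the claim.\<close>
  define u where "u m = (if m \<in> A then cmod (of_real R - w) else 1)" for m
  define v where "v m = (if m \<in> A then cmod (of_real R + w) else exp (4 * Re w / c m))" for m
  have factor: "cmod (1 - of_real s * w / of_real (c m)) * u m \<le> cmod (1 - w / of_real (c m)) * v m" for m
  proof (cases "m \<in> A")
    case True
    then show ?thesis
      using cmod_one_minus_scaled_le_Blaschke[OF assms(2,3,1,4,5) c_pos] by (simp add: u_def v_def)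
  next
    case False
    then have "cmod (w / of_real (c m)) \<le> 1/2"
      using assms c_pos[of m] by (simp add: A_def norm_divide field_simps)
    from cmod_one_minus_scaled_le_exp[OF this, of s] show ?thesis
      using False assms c_pos[of m] by (simp add: u_def v_def)
  qed
  have "cmod (\<Prod>m<M. 1 - of_real s * w / of_real (c m)) * cmod (of_real R - w) ^ n
    \<le> cmod (\<Prod>m<M. 1 - w / of_real (c m)) * cmod (of_real R + w) ^ n * exp (4 * tail_weight c R * Re w)"
    if "M \<ge> N" for M
  proof -
    have sub: "{..<M} \<inter> A = A" using N that by auto
    have pu: "(\<Prod>m<M. u m) = cmod (of_real R - w) ^ n"
      unfolding u_def n_def by (simp add: prod.If_cases sub flip: A_def)
    have "(\<Prod>m<M. v m) = cmod (of_real R + w) ^ n * (\<Prod>m\<in>{..<M} - A. exp (4 * Re w / c m))"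
      unfolding v_def n_def by (simp add: prod.If_cases sub Diff_eq flip: A_def)
    also have "(\<Prod>m\<in>{..<M} - A. exp (4 * Re w / c m)) = exp (4 * Re w * (\<Sum>m<M. if c m \<le> 2 * R then 0 else 1 / c m))"
      by (subst exp_sum[symmetric]) (auto simp: sum.If_cases sum_distrib_left Diff_eq A_def Compl_eq)
    also have "\<dots> \<le> exp (4 * tail_weight c R * Re w)"
      using mult_left_mono[OF sum_above_le_tail_weight[OF \<open>R > 0\<close>, of M], of "4 * Re w"] assms(1)
      by (simp add: mult_ac)
    finally have pv: "(\<Prod>m<M. v m) \<le> cmod (of_real R + w) ^ n * exp (4 * tail_weight c R * Re w)"
      by (simp add: mult_left_mono)
    have "cmod (\<Prod>m<M. 1 - of_real s * w / of_real (c m)) * (\<Prod>m<M. u m)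
        = (\<Prod>m<M. cmod (1 - of_real s * w / of_real (c m)) * u m)"
      by (simp add: prod.distrib prod_norm)
    also have "\<dots> \<le> (\<Prod>m<M. cmod (1 - w / of_real (c m)) * v m)"
      by (rule prod_mono) (use factor in \<open>auto simp: u_def\<close>)
    also have "\<dots> = cmod (\<Prod>m<M. 1 - w / of_real (c m)) * (\<Prod>m<M. v m)"
      by (simp add: prod.distrib prod_norm)
    also have "\<dots> \<le> cmod (\<Prod>m<M. 1 - w / of_real (c m)) * (cmod (of_real R + w) ^ n * exp (4 * tail_weight c R * Re w))"
      by (rule mult_left_mono[OF pv]) simp
    finally show ?thesis by (simp only: pu mult.assoc)
  qed
  then show "\<exists>N. \<forall>M\<ge>N. cmod (\<Prod>m<M. 1 - of_real s * w / of_real (c m)) * cmod (of_real R - w) ^ n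
    \<le> cmod (\<Prod>m<M. 1 - w / of_real (c m)) * cmod (of_real R + w) ^ n * exp (4 * tail_weight c R * Re w)"
    by blast
qed

lemma canonical_product_dilation_negative_axis:
  assumes "x \<ge> 0" "0 \<le> s" "s \<le> 1"
  shows "cmod (G (- of_real (s * x))) \<le> (\<Prod>m<k. (1 + s * x / c m) / (1 + x / c m)) * cmod (G (- of_real x))"
proof (rule LIMSEQ_le)
  show "(\<lambda>M. cmod (\<Prod>m<M. 1 - (- of_real (s * x)) / of_real (c m))) \<longlonglongrightarrow> cmod (G (- of_real (s * x)))"
    by (intro tendsto_intros G)
  show "(\<lambda>M. (\<Prod>m<k. (1 + s * x / c m) / (1 + x / c m)) * cmod (\<Prod>m<M. 1 - (- of_real x) / of_real (c m)))
    \<longlonglongrightarrow> (\<Prod>m<k. (1 + s * x / c m) / (1 + x / c m)) * cmod (G (- of_real x))"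
    by (intro tendsto_intros G)
  have pos: "1 + y / c m > 0" if "y \<ge> 0" for y m using that c_pos[of m] by (simp add: add_pos_nonneg)
  have norm: "cmod (\<Prod>m<M. 1 - (- of_real y) / of_real (c m)) = (\<Prod>m<M. 1 + y / c m)" if "y \<ge> 0" for y M
  proof -
    have "cmod (1 - (- of_real y) / of_real (c m)) = 1 + y / c m" for m
    proof -
      have "1 - (- of_real y) / of_real (c m) = (of_real (1 + y / c m) :: complex)" by simp
      then show ?thesis using pos[OF that, of m] by (metis norm_of_real abs_of_pos)
    qed
    then show ?thesis by (simp add: prod_norm[symmetric])
  qed
  have sx: "0 \<le> s * x" "s * x \<le> x" using assms by (auto simp: mult_left_le_one_le)
  have "(\<Prod>m<M. 1 + s * x / c m) \<le> (\<Prod>m<k. (1 + s * x / c m) / (1 + x / c m)) * (\<Prod>m<M. 1 + x / c m)" if "M \<ge> k" for M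
  proof -
    have split: "(\<Prod>m<M. h m) = (\<Prod>m<k. h m) * (\<Prod>m\<in>{k..<M}. h m)" for h :: "nat \<Rightarrow> real"
      using prod.union_disjoint[of "{..<k}" "{k..<M}" h] that ivl_disj_un(8)[of k M] by (simp add: ivl_disj_un ivl_disj_int)
    have "(\<Prod>m<k. (1 + s * x / c m) / (1 + x / c m)) * (\<Prod>m<M. 1 + x / c m)
       = (\<Prod>m<k. 1 + s * x / c m) * (\<Prod>m\<in>{k..<M}. 1 + x / c m)"
      using pos[OF assms(1)] by (simp add: split[of "\<lambda>m. 1 + x / c m"] prod_dividef less_imp_neq[symmetric])
    moreover have "(\<Prod>m<M. 1 + s * x / c m) \<le> (\<Prod>m<k. 1 + s * x / c m) * (\<Prod>m\<in>{k..<M}. 1 + x / c m)"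
      unfolding split[of "\<lambda>m. 1 + s * x / c m"]
      using pos[OF sx(1)] sx c_pos
      by (intro mult_left_mono prod_mono prod_nonneg) (auto simp: less_imp_le divide_right_mono)
    ultimately show ?thesis by simp
  qed
  then show "\<exists>N. \<forall>M\<ge>N. cmod (\<Prod>m<M. 1 - (- of_real (s * x)) / of_real (c m))
    \<le> (\<Prod>m<k. (1 + s * x / c m) / (1 + x / c m)) * cmod (\<Prod>m<M. 1 - (- of_real x) / of_real (c m))"
    unfolding norm[OF assms(1)] norm[OF sx(1)] by blast
qed

text \<open>
  For \<open>x \<rightarrow> \<infinity>\<close> each factor of the ratio tends to \<open>s\<close>, and all factors are at most 1; so the limit
  superior of the ratio is at most \<open>s ^ k\<close> for every \<open>k\<close>.
\<close>
lemma canonical_product_dilation_negative_axis_tendsto_0: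
  assumes "0 \<le> s" "s < 1"
  shows "((\<lambda>x. cmod (G (- of_real (s * x))) / cmod (G (- of_real x))) \<longlongrightarrow> 0) at_top"
proof (rule tendstoI)
  fix e :: real assume "e > 0"
  then obtain k where k: "s ^ k < e" using real_arch_pow_inv[OF _ assms(2)] by blast
  have "((\<lambda>x. (1 + s * x / c m) / (1 + x / c m)) \<longlongrightarrow> s) at_top" for m
    using c_pos[of m] by real_asymp
  then have "((\<lambda>x. \<Prod>m<k. (1 + s * x / c m) / (1 + x / c m)) \<longlongrightarrow> (\<Prod>m<k. s)) at_top"
    by (intro tendsto_prod)
  then have "\<forall>\<^sub>F x in at_top. (\<Prod>m<k. (1 + s * x / c m) / (1 + x / c m)) < e"
    using k by (intro order_tendstoD(2)) auto
  then show "\<forall>\<^sub>F x in at_top. dist (cmod (G (- of_real (s * x))) / cmod (G (- of_real x))) 0 < e"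
    using eventually_ge_at_top[of 0]
  proof eventually_elim
    case (elim x)
    have "cmod (G (of_real 0 * (- of_real x))) \<le> cmod (G (- of_real x))"
      by (rule canonical_product_dilation_left) (use elim in auto)
    then have "1 \<le> cmod (G (- of_real x))" by (simp add: canonical_product_0)
    then have "cmod (G (- of_real x)) > 0" by linarith
    with canonical_product_dilation_negative_axis[OF elim(2) assms(1), of k] assms elim show ?case
      by (auto simp: divide_le_eq intro: order.strict_trans1[rotated])
  qed
qed

end
end

section \<open>The maximum principle on the half-disc\<close>

lemma Blaschke_power_le_exp:
  assumes "0 \<le> x" "2 * x \<le> R" "R > 0" "real n \<le> 2 * R * T"
  shows "((R + x) / (R - x)) ^ n \<le> exp (8 * x * T)"
proof -
  define u where "u = x / R"
  have u: "0 \<le> u" "u \<le> 1/2" "x = u * R" using assms by (auto simp: u_def field_simps)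
  have "(R + x) / (R - x) = 1 + 2 * u / (1 - u)"
    using u assms by (simp add: field_simps)
  also have "2 * u / (1 - u) \<le> 4 * u"
    using u mult_left_mono[of "1/2" "1-u" "4*u"] by (simp add: field_simps)
  also have "1 + 4 * u \<le> exp (4 * u)" by (rule exp_ge_add_one_self)
  finally have "((R + x) / (R - x)) ^ n \<le> exp (4 * u) ^ n"
    using assms by (intro power_mono) auto
  also have "\<dots> = exp (4 * u * real n)" by (simp add: exp_of_nat_mult[symmetric] mult_ac)
  also have "4 * u * real n \<le> 4 * u * (2 * R * T)"
    using u assms by (intro mult_left_mono) auto
  also have "4 * u * (2 * R * T) = 8 * x * T" using u(3) by simp
  finally show ?thesis by simp
qed

text \<open>
  In the variable \<open>z\<^sup>2\<close> the domain is the right half-disc of radius \<open>R\<close>. The function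
  \<open>((R - z\<^sup>2) / (R + z\<^sup>2)) ^ n * exp (- 4 T z\<^sup>2)\<close> has modulus 1 on the straight part of the boundary, and on the
  arc it absorbs the losses that the hypothesis allows. Undoing it at an interior point costs no more than
  the exponential factor of the conclusion, which tends to 1 when \<open>T\<close> tends to 0.
\<close>
lemma half_disc_bound:
  fixes q :: "complex \<Rightarrow> complex"
  assumes hol: "q holomorphic_on {z. 0 < Re (z\<^sup>2)}"
    and cont: "continuous_on {z. 0 \<le> Re (z\<^sup>2)} q"
    and R: "R > 0" and K: "K \<ge> 0" and T: "real n \<le> 2 * R * T"
    and side: "\<And>z. Re (z\<^sup>2) = 0 \<Longrightarrow> cmod z ^ 2 \<le> R \<Longrightarrow> cmod (q z) \<le> K"
    and arc: "\<And>z. 0 \<le> Re (z\<^sup>2) \<Longrightarrow> cmod z ^ 2 = R \<Longrightarrow>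
      cmod (q z) * cmod (of_real R - z\<^sup>2) ^ n \<le> K * cmod (of_real R + z\<^sup>2) ^ n * exp (4 * T * Re (z\<^sup>2))"
    and z: "0 \<le> Re (z\<^sup>2)" "2 * cmod z ^ 2 \<le> R"
  shows "cmod (q z) \<le> K * exp (12 * (cmod z)\<^sup>2 * T)"
proof -
  define S where "S = {z. 0 < Re (z\<^sup>2) \<and> cmod z ^ 2 < R}"
  define D where "D = {z. 0 \<le> Re (z\<^sup>2) \<and> cmod z ^ 2 \<le> R}"
  define h where "h z = q z * ((of_real R - z\<^sup>2) / (of_real R + z\<^sup>2)) ^ n * exp (- (4 * of_real T * z\<^sup>2))" for z
  have T0: "T \<ge> 0"
  proof (rule ccontr)
    assume "\<not> T \<ge> 0"
    then have "2 * R * T < 0" using R by (simp add: mult_pos_neg)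
    then show False using T by linarith
  qed
  have nz: "of_real R + z\<^sup>2 \<noteq> 0" if "0 \<le> Re (z\<^sup>2)" for z :: complex
  proof
    assume "of_real R + z\<^sup>2 = 0"
    then have "Re (of_real R + z\<^sup>2) = 0" by simp
    then show False using that R by simp
  qed
  have norm_h: "cmod (h z) = cmod (q z) * (cmod (of_real R - z\<^sup>2) / cmod (of_real R + z\<^sup>2)) ^ n
      * exp (- (4 * T * Re (z\<^sup>2)))" for z
    by (simp add: h_def norm_mult norm_power norm_divide)
  have openS: "open S" unfolding S_def by (intro open_Collect_conj open_Collect_less continuous_intros)
  have closedD: "closed D" unfolding D_def by (intro closed_Collect_conj closed_Collect_le continuous_intros)
  have clS: "closure S \<subseteq> D" by (rule closure_minimal[OF _ closedD]) (auto simp: S_def D_def)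
  have bound: "cmod (h z) \<le> K" if "z \<in> frontier S" for z
  proof -
    have zD: "0 \<le> Re (z\<^sup>2)" "cmod z ^ 2 \<le> R" using that clS by (auto simp: frontier_def D_def)
    have "z \<notin> S" using that openS by (simp add: frontier_def interior_open)
    then consider "Re (z\<^sup>2) = 0" | "cmod z ^ 2 = R" using zD by (fastforce simp: S_def)
    then show ?thesis
    proof cases
      case 1
      have "cmod (of_real R - z\<^sup>2) = cmod (of_real R + z\<^sup>2)"
        using 1 by (simp add: cmod_def)
      then show ?thesis using side[OF 1 zD(2)] nz[OF zD(1)] 1 by (simp add: norm_h)
    next
      case 2
      define p where "p = cmod (of_real R + z\<^sup>2)"
      have p: "p > 0" using nz[OF zD(1)] by (simp add: p_def)
      have "cmod (h z) = cmod (q z) * cmod (of_real R - z\<^sup>2) ^ n / (p ^ n * exp (4 * T * Re (z\<^sup>2)))"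
        using p by (simp add: norm_h p_def power_divide exp_minus field_simps)
      also have "\<dots> \<le> K"
        using arc[OF zD(1) 2] p by (simp add: p_def[symmetric] divide_le_eq mult.assoc)
      finally show ?thesis .
    qed
  qed
  show ?thesis
  proof (cases "Re (z\<^sup>2) = 0")
    case True
    have "(cmod z)\<^sup>2 \<ge> 0" by simp
    then have "cmod z ^ 2 \<le> R" using z(2) by linarith
    from side[OF True this] have "cmod (q z) \<le> K * 1" by simp
    also have "\<dots> \<le> K * exp (12 * (cmod z)\<^sup>2 * T)"
      using T0 K by (intro mult_left_mono) auto
    finally show ?thesis .
  next
    case False
    have "(cmod z)\<^sup>2 \<ge> 0" by simp
    then have zS: "z \<in> S" using False z R by (auto simp: S_def)
    have hz: "cmod (h z) \<le> K"
    proof (rule maximum_modulus_frontier[of h S])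
      show "h holomorphic_on interior S"
        unfolding h_def interior_open[OF openS]
        by (intro holomorphic_intros holomorphic_on_subset[OF hol]) (auto simp: S_def nz)
      have "continuous_on D h" unfolding h_def
        by (intro continuous_intros continuous_on_subset[OF cont]) (auto simp: D_def nz)
      then show "continuous_on (closure S) h" using clS continuous_on_subset by blast
      show "bounded S"
        by (rule bounded_subset[OF bounded_cball[of 0 "sqrt R"]])
           (auto simp: S_def intro!: real_le_rsqrt)
    qed (use bound zS in auto)
    define x where "x = (cmod z)\<^sup>2"
    have x: "0 \<le> x" "2 * x \<le> R" using z by (auto simp: x_def)
    have nx: "cmod (z\<^sup>2) = x" by (simp add: x_def norm_power)
    define k where "k = (cmod (of_real R - z\<^sup>2) / cmod (of_real R + z\<^sup>2)) ^ n"
    have lo: "R - x \<le> cmod (of_real R - z\<^sup>2)"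
      using norm_triangle_ineq2[of "of_real R" "z\<^sup>2"] R nx by simp
    have hi: "cmod (of_real R + z\<^sup>2) \<le> R + x"
      using norm_triangle_ineq[of "of_real R" "z\<^sup>2"] R nx by simp
    have pos: "0 < R - x" using x R by linarith
    have kpos: "k > 0" unfolding k_def
      using lo pos nz[OF z(1)] by (intro zero_less_power divide_pos_pos) auto
    have "1 / k = (cmod (of_real R + z\<^sup>2) / cmod (of_real R - z\<^sup>2)) ^ n"
      by (simp add: k_def power_divide)
    also have "\<dots> \<le> ((R + x) / (R - x)) ^ n"
      using lo hi pos x R by (intro power_mono frac_le) auto
    also have "\<dots> \<le> exp (8 * x * T)" by (rule Blaschke_power_le_exp[OF x R T])
    finally have k1: "1 / k \<le> exp (8 * x * T)" .
    have "Re (z\<^sup>2) \<le> x" using complex_Re_le_cmod[of "z\<^sup>2"] nx by simp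
    then have e1: "exp (4 * T * Re (z\<^sup>2)) \<le> exp (4 * T * x)"
      using T0 by (simp add: mult_left_mono)
    have "cmod (q z) = cmod (h z) * (1 / k) * exp (4 * T * Re (z\<^sup>2))"
      using kpos by (simp add: norm_h k_def[symmetric] exp_minus)
    also have "\<dots> \<le> K * exp (8 * x * T) * exp (4 * T * x)"
      using hz k1 e1 kpos K by (intro mult_mono) auto
    also have "\<dots> = K * exp (12 * x * T)"
      by (simp add: exp_add[symmetric] algebra_simps)
    finally show ?thesis by (simp add: x_def)
  qed
qed

section \<open>Quotients and growth of entire functions\<close>

text \<open>
  At a zero of \<open>g\<close> the order condition excludes a pole of \<open>f / g\<close>, so that the singularity is removable.
\<close>
lemma entire_quotient:
  fixes f g :: "complex \<Rightarrow> complex"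
  assumes f: "f holomorphic_on UNIV" "f a \<noteq> 0" and g: "g holomorphic_on UNIV" "g b \<noteq> 0"
    and ord: "\<And>z. g z = 0 \<Longrightarrow> zorder g z \<le> zorder f z"
  obtains q where "q holomorphic_on UNIV" "\<And>z. f z = q z * g z"
    "\<And>z. zorder f z = zorder g z \<Longrightarrow> q z \<noteq> 0"
proof -
  have ana: "f analytic_on {z}" "g analytic_on {z}" for z
    using f g by (auto intro: holomorphic_on_imp_analytic_at)
  have ev: "\<forall>\<^sub>F w in at z. f w \<noteq> 0" "\<forall>\<^sub>F w in at z. g w \<noteq> 0" for z
    using non_zero_neighbour_alt[OF f(1) open_UNIV connected_UNIV _ _ f(2), of z]
      non_zero_neighbour_alt[OF g(1) open_UNIV connected_UNIV _ _ g(2), of z] by auto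
  define h where "h z = f z / g z" for z
  define q where "q = remove_sings h"
  have anah: "h analytic_on {z}" if "g z \<noteq> 0" for z
    unfolding h_def by (intro analytic_intros ana) (use that in auto)
  have mero: "h meromorphic_on {z}" for z
    unfolding h_def by (intro meromorphic_intros analytic_on_imp_meromorphic_on ana)
  have anaq: "q analytic_on {z}" for z
  proof (cases "g z = 0")
    case False
    then show ?thesis unfolding q_def by (intro remove_sings_analytic_on anah)
  next
    case True
    have "zorder h z = zorder f z - zorder g z" unfolding h_def
      by (rule zorder_divide) (auto intro!: analytic_on_imp_meromorphic_on ana eventually_frequently ev)
    then have "zorder h z \<ge> 0" using ord[OF True] by simp
    moreover have evh: "\<forall>\<^sub>F w in at z. h w \<noteq> 0"
      using ev[of z] by eventually_elim (auto simp: h_def)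
    ultimately have "\<not> is_pole h z"
      using isolated_pole_imp_neg_zorder mero meromorphic_at_iff by fastforce
    then obtain c where "h \<midarrow>z\<rightarrow> c"
      using mero[of z] by (auto simp: meromorphic_at_iff not_essential_def)
    then show ?thesis
      unfolding q_def using mero meromorphic_at_iff remove_sings_analytic_at by blast
  qed
  then have holq: "q holomorphic_on UNIV"
    by (meson analytic_imp_holomorphic analytic_on_def UNIV_I insertI1)
  have eq: "f z = q z * g z" for z
  proof (rule LIM_unique)
    have "isCont q z" "isCont g z" "isCont f z" using anaq ana analytic_at_imp_isCont by blast+
    then have f: "f \<midarrow>z\<rightarrow> f z" and lim: "(\<lambda>w. q w * g w) \<midarrow>z\<rightarrow> q z * g z"
      by (auto simp: isCont_def intro!: tendsto_intros)
    have "\<forall>\<^sub>F w in at z. q w * g w = f w"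
      using ev(2)[of z]
    proof eventually_elim
      case (elim w)
      then have "q w = h w" unfolding q_def by (intro remove_sings_at_analytic anah)
      then show ?case using elim by (simp add: h_def)
    qed
    then show "f \<midarrow>z\<rightarrow> q z * g z"
      using Lim_transform_eventually[OF lim] by blast
    show "f \<midarrow>z\<rightarrow> f z" by fact
  qed
  have "q z \<noteq> 0" if "zorder f z = zorder g z" for z
  proof -
    have "zorder (\<lambda>z. q z * g z) z = zorder q z + zorder g z"
      by (intro zorder_times_analytic anaq ana) (use ev(1)[of z] eq in auto)
    then have 0: "zorder q z = 0" using that eq by (simp flip: eq[abs_def])
    have "\<forall>\<^sub>F w in at z. q w \<noteq> 0" using ev(1)[of z] by eventually_elim (auto simp: eq)
    then have "\<exists>\<^sub>F w in at z. q w \<noteq> 0" by (rule eventually_frequently[OF at_neq_bot])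
    then show ?thesis using zorder_eq_0_iff[OF anaq[of z]] 0 by simp
  qed
  with holq eq that show thesis by blast
qed

lemma even_quotient:
  fixes f g q :: "complex \<Rightarrow> complex"
  assumes q: "q holomorphic_on UNIV" and g: "g holomorphic_on UNIV" "g b \<noteq> 0"
    and eq: "\<And>z. f z = q z * g z" and even: "\<And>z. f (- z) = f z" "\<And>z. g (- z) = g z"
  shows "q (- z) = q z"
proof -
  define e where "e z = q (- z) - q z" for z
  have "e holomorphic_on UNIV"
    using holomorphic_on_compose_gen[OF holomorphic_on_minus[OF holomorphic_on_ident] q]
    unfolding e_def by (auto simp: o_def intro!: holomorphic_intros q)
  then have lim: "e \<midarrow>z\<rightarrow> e z"
    using holomorphic_on_imp_continuous_on continuous_on_eq_continuous_at isContD open_UNIV by blast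
  have "e w = 0" if "g w \<noteq> 0" for w
    using eq[of w] eq[of "- w"] even(1)[of w] even(2)[of w] that by (simp add: e_def)
  moreover have "\<forall>\<^sub>F w in at z. g w \<noteq> 0"
    using non_zero_neighbour_alt[OF g(1) open_UNIV connected_UNIV, of z b] g(2) by simp
  ultimately have "\<forall>\<^sub>F w in at z. e w = 0" by (auto elim: eventually_mono)
  then have "e \<midarrow>z\<rightarrow> 0" by (rule tendsto_eventually)
  then have "e z = 0" using lim tendsto_unique[OF at_neq_bot] by blast
  then show ?thesis by (simp add: e_def)
qed

text \<open>
  By Liouville such a function is a polynomial of degree at most two; evenness removes the linear term, and
  the growth along the imaginary axis the quadratic one.
\<close>
lemma even_entire_constI:
  fixes f :: "complex \<Rightarrow> complex"
  assumes hol: "f holomorphic_on UNIV" and even: "\<And>z. f (- z) = f z"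
    and quad: "\<And>z. r \<le> cmod z \<Longrightarrow> cmod (f z) \<le> B * cmod z ^ 2"
    and little: "((\<lambda>y::real. f (\<i> * of_real y) / of_real (y\<^sup>2)) \<longlongrightarrow> 0) at_top"
  shows "f z = f 0"
proof -
  define p q where "p = deriv f 0" and "q = deriv (deriv f) 0 / 2"
  have poly: "f w = f 0 + p * w + q * w\<^sup>2" for w
    using Liouville_polynomial[OF hol quad, where \<xi> = w] by (simp add: numeral_2_eq_2 p_def q_def)
  have "p = 0" using even[of 1] poly[of 1] poly[of "-1"] by simp
  have "((\<lambda>y::real. f 0 / of_real (y\<^sup>2) - q) \<longlongrightarrow> 0 - q) at_top"
  proof (intro tendsto_intros)
    have "((\<lambda>y::real. of_real (1 / y\<^sup>2) :: complex) \<longlongrightarrow> of_real 0) at_top"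
      by (intro tendsto_of_real) real_asymp
    from tendsto_mult[OF tendsto_const[of "f 0"] this]
    show "((\<lambda>y::real. f 0 / of_real (y\<^sup>2)) \<longlongrightarrow> 0) at_top" by simp
  qed
  moreover have "\<forall>\<^sub>F y::real in at_top. f 0 / of_real (y\<^sup>2) - q = f (\<i> * of_real y) / of_real (y\<^sup>2)"
    using eventually_gt_at_top[of 0]
  proof eventually_elim
    case (elim y)
    then show ?case
      by (subst poly[of "\<i> * of_real y"]) (simp add: \<open>p = 0\<close> power_mult_distrib field_simps)
  qed
  ultimately have "((\<lambda>y::real. f (\<i> * of_real y) / of_real (y\<^sup>2)) \<longlongrightarrow> 0 - q) at_top"
    by (rule Lim_transform_eventually)
  from tendsto_unique[OF _ this little] have "q = 0" by simp
  then show ?thesis using poly[of z] \<open>p = 0\<close> by simp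
qed

text \<open>
  The transformation \<open>v \<mapsto> v / (2 M - v)\<close> maps the half-plane \<open>Re v < M\<close> into the unit disc, so that the
  Schwarz lemma applies. At half the radius the resulting constant is 2.
\<close>
lemma Borel_Caratheodory:
  fixes f :: "complex \<Rightarrow> complex"
  assumes hol: "f holomorphic_on ball 0 R" and "f 0 = 0"
    and Re: "\<And>z. cmod z < R \<Longrightarrow> Re (f z) < M" and z: "2 * cmod z \<le> R" "R > 0"
  shows "cmod (f z) \<le> 2 * M"
proof -
  have M: "M > 0" using Re[of 0] assms by simp
  define \<phi> where "\<phi> u = f (of_real R * u) / (of_real (2 * M) - f (of_real R * u))" for u
  have less: "cmod (f w) < cmod (of_real (2 * M) - f w)" if "cmod w < R" for w
  proof (rule power2_less_imp_less)
    have "M * Re (f w) < M * M" using Re[OF that] M by simp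
    then show "(cmod (f w))\<^sup>2 < (cmod (of_real (2 * M) - f w))\<^sup>2"
      unfolding cmod_power2 by (simp add: power2_eq_square algebra_simps)
  qed auto
  have small: "cmod (of_real R * u) < R" if "cmod u < 1" for u
    using that \<open>R > 0\<close> by (simp add: norm_mult)
  have nz: "of_real (2 * M) - f (of_real R * u) \<noteq> 0" if "cmod u < 1" for u
    using less[OF small[OF that]] by (smt (verit) norm_ge_zero norm_zero)
  have holR: "(\<lambda>u. f (of_real R * u)) holomorphic_on ball 0 1"
    using holomorphic_on_compose_gen[OF _ hol, of "\<lambda>u. of_real R * u" "ball 0 1"] small
    by (force simp: o_def intro!: holomorphic_intros)
  have "cmod (\<phi> (z / of_real R)) \<le> cmod (z / of_real R)"
  proof (rule Schwarz_Lemma(1))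
    show "\<phi> holomorphic_on ball 0 1"
      unfolding \<phi>_def by (intro holomorphic_intros holR) (use nz in auto)
    show "\<phi> 0 = 0" by (simp add: \<phi>_def \<open>f 0 = 0\<close>)
    show "cmod (\<phi> u) < 1" if "cmod u < 1" for u
    proof -
      have "cmod (f (of_real R * u)) < cmod (of_real (2 * M) - f (of_real R * u))" by (rule less[OF small[OF that]])
      moreover then have "0 < cmod (of_real (2 * M) - f (of_real R * u))" by (smt (verit) norm_ge_zero)
      ultimately show ?thesis by (simp add: \<phi>_def norm_divide)
    qed
    show "cmod (z / of_real R) < 1" using z by (simp add: norm_divide)
  qed
  also have "cmod (z / of_real R) \<le> 1 / 2" using z by (simp add: norm_divide field_simps)
  finally have "cmod (f z) \<le> 1/2 * cmod (of_real (2 * M) - f z)"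
    using z nz[of "z / of_real R"] by (simp add: \<phi>_def norm_divide field_simps)
  also have "cmod (of_real (2 * M) - f z) \<le> 2 * M + cmod (f z)"
    using norm_triangle_ineq4[of "of_real (2*M)" "f z"] M by simp
  finally show ?thesis by simp
qed

text \<open>
  Order less than two, or order two and minimal type, expressed in one condition without iterated
  logarithms.
\<close>
definition minimal_type2 :: "(complex \<Rightarrow> complex) \<Rightarrow> bool" where
  "minimal_type2 f \<longleftrightarrow> (\<forall>\<epsilon>>0. \<forall>\<^sub>F r in at_top. \<forall>z. cmod z = r \<longrightarrow> cmod (f z) \<le> exp (\<epsilon> * r\<^sup>2))"

lemma minimal_type2_disc:
  assumes "minimal_type2 f" "f holomorphic_on UNIV" "\<epsilon> > 0"
  shows "\<forall>\<^sub>F R in at_top. \<forall>z. cmod z ^ 2 \<le> R \<longrightarrow> cmod (f z) \<le> exp (\<epsilon> * R)"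
proof -
  have "\<forall>\<^sub>F R in at_top. \<forall>z. cmod z = sqrt R \<longrightarrow> cmod (f z) \<le> exp (\<epsilon> * (sqrt R)\<^sup>2)"
    using assms(1,3) sqrt_at_top unfolding minimal_type2_def filterlim_iff by blast
  then show ?thesis using eventually_gt_at_top[of 0]
  proof eventually_elim
    case (elim R)
    show ?case
    proof (intro allI impI)
      fix z assume "cmod z ^ 2 \<le> R"
      then have z: "z \<in> cball 0 (sqrt R)" by (simp add: real_le_rsqrt)
      show "cmod (f z) \<le> exp (\<epsilon> * R)"
      proof (rule maximum_modulus_frontier[OF _ _ _ _ z])
        show "f holomorphic_on interior (cball 0 (sqrt R))" using assms(2) holomorphic_on_subset by blast
        show "continuous_on (closure (cball 0 (sqrt R))) f"
          using assms(2) holomorphic_on_imp_continuous_on continuous_on_subset by blast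
      qed (use elim in auto)
    qed
  qed
qed

text \<open>
  A logarithm of \<open>E\<close> has real part \<open>o(|z|\<^sup>2)\<close>, hence is itself \<open>o(|z|\<^sup>2)\<close> by Borel-Caratheodory, and an even
  entire function of that growth is constant.
\<close>
lemma zero_free_minimal_type2:
  fixes E :: "complex \<Rightarrow> complex"
  assumes hol: "E holomorphic_on UNIV" and even: "\<And>z. E (- z) = E z" and nz: "\<And>z. E z \<noteq> 0"
    and E0: "E 0 = 1" and growth: "minimal_type2 E"
  shows "E z = 1"
proof -
  obtain h where h: "h holomorphic_on UNIV" "\<And>z. E z = exp (h z)"
    using contractible_imp_holomorphic_log[of E UNIV] hol nz by auto
  \<comment> \<open>Symmetrising makes evenness immediate; the price is that \<open>exp f\<close> is \<open>E\<^sup>2\<close> instead of \<open>E\<close>.\<close>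
  define f where "f z = h z + h (- z) - 2 * h 0" for z
  have "(\<lambda>z. h (- z)) holomorphic_on UNIV"
    using holomorphic_on_compose_gen[OF holomorphic_on_minus[OF holomorphic_on_ident] h(1)] by (simp add: o_def)
  then have holf: "f holomorphic_on UNIV"
    unfolding f_def by (intro holomorphic_intros h)
  have f0: "f 0 = 0" and evenf: "f (- z) = f z" for z by (simp_all add: f_def)
  have "exp (f z) = E z * E (- z) / (E 0)\<^sup>2" for z
    by (simp add: f_def h(2) exp_add exp_diff exp_double)
  then have expf: "exp (f z) = (E z)\<^sup>2" for z by (simp add: even E0 power2_eq_square)
  have Ref: "exp (Re (f z)) = (cmod (E z))\<^sup>2" for z
    using expf[of z] by (metis norm_exp_eq_Re norm_power)
  have small: "\<forall>\<^sub>F r in at_top. \<forall>z. cmod z = r \<longrightarrow> cmod (f z) \<le> \<epsilon> * r\<^sup>2" if "\<epsilon> > 0" for \<epsilon>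
  proof -
    \<comment> \<open>The bound on the circle of radius \<open>2 r\<close> enters as \<open>2 * 3 \<delta> (2 r)\<^sup>2 = 24 \<delta> r\<^sup>2\<close>.\<close>
    define \<delta> where "\<delta> = \<epsilon> / 24"
    have "\<delta> > 0" using that by (simp add: \<delta>_def)
    have lim: "filterlim (\<lambda>r::real. (2 * r)\<^sup>2) at_top at_top" by real_asymp
    have "\<forall>\<^sub>F r in at_top. \<forall>z. cmod z ^ 2 \<le> (2 * r)\<^sup>2 \<longrightarrow> cmod (E z) \<le> exp (\<delta> * (2 * r)\<^sup>2)"
      using minimal_type2_disc[OF growth hol \<open>\<delta> > 0\<close>] lim unfolding filterlim_iff by blast
    then show ?thesis using eventually_gt_at_top[of 0]
    proof eventually_elim
      case (elim r)
      show ?case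
      proof (intro allI impI)
        fix z assume z: "cmod z = r"
        have "cmod (f z) \<le> 2 * (3 * \<delta> * (2 * r)\<^sup>2)"
        proof (rule Borel_Caratheodory[where f = f and z = z and R = "2 * r"])
          fix w assume "cmod w < 2 * r"
          then have "cmod w ^ 2 \<le> (2 * r)\<^sup>2" by (intro power_mono) auto
          with elim have "cmod (E w) \<le> exp (\<delta> * (2 * r)\<^sup>2)" by blast
          then have "exp (Re (f w)) \<le> exp (\<delta> * (2 * r)\<^sup>2) ^ 2" unfolding Ref by (intro power_mono) auto
          also have "\<dots> = exp (2 * \<delta> * (2 * r)\<^sup>2)" by (simp add: exp_double[symmetric] mult_ac)
          finally have "Re (f w) \<le> 2 * \<delta> * (2 * r)\<^sup>2" by simp
          moreover have "\<delta> * (2 * r)\<^sup>2 > 0" using elim \<open>\<delta> > 0\<close> by simp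
          ultimately show "Re (f w) < 3 * \<delta> * (2 * r)\<^sup>2" by linarith
        qed (use z elim f0 holf holomorphic_on_subset in auto)
        then show "cmod (f z) \<le> \<epsilon> * r\<^sup>2" by (simp add: \<delta>_def power_mult_distrib)
      qed
    qed
  qed
  obtain r where r: "\<And>s z. r \<le> s \<Longrightarrow> cmod z = s \<Longrightarrow> cmod (f z) \<le> 1 * s\<^sup>2"
    using small[of 1] by (auto simp: eventually_at_top_linorder)
  have fz: "f z = 0" for z
  proof -
    have "f z = f 0"
    proof (rule even_entire_constI[OF holf evenf])
      show "cmod (f z) \<le> 1 * (cmod z)\<^sup>2" if "r \<le> cmod z" for z using r that by blast
      show "((\<lambda>y::real. f (\<i> * of_real y) / of_real (y\<^sup>2)) \<longlongrightarrow> 0) at_top"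
      proof (rule tendstoI)
        fix e :: real assume "e > 0"
        then have "e / 2 > 0" by simp
        from small[OF this] eventually_gt_at_top[of 0]
        show "\<forall>\<^sub>F y in at_top. dist (f (\<i> * complex_of_real y) / of_real (y\<^sup>2)) 0 < e"
        proof eventually_elim
          case (elim y)
          have "cmod (\<i> * of_real y) = y" using elim by (simp add: norm_mult)
          then have "cmod (f (\<i> * of_real y)) \<le> e / 2 * y\<^sup>2" using elim(1) by blast
          also have "\<dots> < e * y\<^sup>2" using elim \<open>e > 0\<close> by simp
          finally show ?case using elim by (simp add: norm_divide norm_power field_simps)
        qed
      qed
    qed
    then show ?thesis using f0 by simp
  qed
  have sq: "(E w)\<^sup>2 = 1" for w using expf[of w] fz[of w] by simp
  have "E constant_on UNIV"
  proof (rule continuous_finite_range_constant)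
    show "continuous_on UNIV E" using hol holomorphic_on_imp_continuous_on by blast
    have "range E \<subseteq> {1, -1}" using sq by (auto simp: power2_eq_1_iff)
    then show "finite (range E)" using finite_subset by blast
  qed auto
  then show ?thesis using E0 unfolding constant_on_def by (metis UNIV_I)
qed

section \<open>Hadamard factorisation for even functions of minimal type\<close>

text \<open>
  The Weierstrass product of genus 1 over the interleaved zeros \<open>\<lambda>\<^sub>0, -\<lambda>\<^sub>0, \<lambda>\<^sub>1, -\<lambda>\<^sub>1, \<dots>\<close>. In a pair of
  opposite zeros the exponential factors cancel, so its even partial products are those of the claim, while
  the multiplicities of its zeros come from the Weierstrass theory.
\<close>
lemma symmetric_canonical_product:
  fixes lam :: "nat \<Rightarrow> real"
  assumes pos: "\<And>n. lam n > 0" and summ: "summable (\<lambda>n. 1 / (lam n)\<^sup>2)"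
  obtains W where "W holomorphic_on UNIV"
    "\<And>z. (\<lambda>M. \<Prod>m<M. 1 - z\<^sup>2 / of_real ((lam m)\<^sup>2)) \<longlonglongrightarrow> W z"
    "\<And>z. W z = 0 \<longleftrightarrow> z \<in> (\<Union>n. {of_real (lam n), - of_real (lam n)})"
    "\<And>n. zorder W (of_real (lam n)) = int (card {m. lam m = lam n})"
    "\<And>n. zorder W (- of_real (lam n)) = int (card {m. lam m = lam n})"
proof -
  define a where "a n = (if even n then of_real (lam (n div 2)) else - of_real (lam (n div 2)) :: complex)" for n
  have norm_a: "cmod (a n) = lam (n div 2)" for n using pos[of "n div 2"] by (auto simp: a_def)
  have summ2: "summable (\<lambda>n. 1 / (lam (n div 2))\<^sup>2)"
  proof -
    have "(\<lambda>n. 1 / (lam n)\<^sup>2) sums suminf (\<lambda>n. 1 / (lam n)\<^sup>2)" using summ by (rule summable_sums)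
    from sums_if[OF this this] have "summable (\<lambda>n. if even n then 1 / (lam (n div 2))\<^sup>2 else 1 / (lam ((n - 1) div 2))\<^sup>2)"
      by (rule sums_summable)
    also have "(\<lambda>n. if even n then 1 / (lam (n div 2))\<^sup>2 else 1 / (lam ((n - 1) div 2))\<^sup>2) = (\<lambda>n. 1 / (lam (n div 2))\<^sup>2)"
      by (auto simp: fun_eq_iff elim!: oddE)
    finally show ?thesis .
  qed
  interpret W: weierstrass_product a "\<lambda>_. 1"
  proof
    show "a n \<noteq> 0" for n using pos[of "n div 2"] by (auto simp: a_def)
    have "(\<lambda>n. 1 / (lam (n div 2))\<^sup>2) \<longlonglongrightarrow> 0" by (rule summable_LIMSEQ_zero[OF summ2])
    then have "filterlim (\<lambda>n. inverse (1 / (lam (n div 2))\<^sup>2)) at_top sequentially"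
      by (rule filterlim_inverse_at_top) (use pos in \<open>auto simp: less_imp_neq[symmetric]\<close>)
    then have "filterlim (\<lambda>n. sqrt ((lam (n div 2))\<^sup>2)) at_top sequentially"
      by (intro filterlim_compose[OF sqrt_at_top]) simp
    then have "filterlim (\<lambda>n. cmod (a n)) at_top sequentially"
      using pos by (simp add: norm_a less_imp_le)
    then show "filterlim a at_infinity sequentially"
      using filterlim_at_infinity_conv_norm_at_top by blast
    show "summable (\<lambda>n. (r / cmod (a n)) ^ Suc 1)" if "r > 0" for r
      using summable_mult[OF summ2, of "r\<^sup>2"] by (simp add: norm_a power_divide power2_eq_square)
  qed
  define W where "W = W.f"
  have lim: "(\<lambda>M. \<Prod>m<M. 1 - z\<^sup>2 / of_real ((lam m)\<^sup>2)) \<longlonglongrightarrow> W z" for z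
  proof -
    have "(\<lambda>N. \<Prod>n<N. weierstrass_factor 1 (z / a n)) \<longlonglongrightarrow> W z"
      unfolding W_def
      by (rule tendsto_uniform_limitI[OF W.uniform_limit[of "cmod z + 1"]])
         (auto intro: add_nonneg_pos)
    then have "(\<lambda>N. \<Prod>n<2 * N. weierstrass_factor 1 (z / a n)) \<longlonglongrightarrow> W z"
      by (rule filterlim_compose) (rule mult_nat_left_at_top, simp)
    also have "(\<lambda>N. \<Prod>n<2 * N. weierstrass_factor 1 (z / a n)) = (\<lambda>M. \<Prod>m<M. 1 - z\<^sup>2 / of_real ((lam m)\<^sup>2))"
    proof
      fix N
      have pair: "weierstrass_factor 1 u * weierstrass_factor 1 (- u) = 1 - u\<^sup>2" for u
      proof -
        have "weierstrass_factor 1 u * weierstrass_factor 1 (- u) = (1 - u\<^sup>2) * (exp u * exp (- u))"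
          by (simp add: weierstrass_factor_def power2_eq_square algebra_simps)
        then show ?thesis by (simp flip: exp_add)
      qed
      show "(\<Prod>n<2 * N. weierstrass_factor 1 (z / a n)) = (\<Prod>m<N. 1 - z\<^sup>2 / of_real ((lam m)\<^sup>2))"
      proof (induction N)
        case (Suc N)
        have "(\<Prod>n<2 * Suc N. weierstrass_factor 1 (z / a n))
          = (\<Prod>n<2 * N. weierstrass_factor 1 (z / a n)) *
            (weierstrass_factor 1 (z / of_real (lam N)) * weierstrass_factor 1 (- (z / of_real (lam N))))"
          by (simp add: a_def mult.assoc)
        then show ?case by (simp only: pair Suc.IH) (simp add: power_divide)
      qed simp
    qed
    finally show ?thesis .
  qed
  have card_even: "card (a -` {of_real (lam n)}) = card {m. lam m = lam n}" for n
  proof (rule bij_betw_same_card[symmetric])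
    have "bij_betw (\<lambda>m. 2 * m) {m. lam m = lam n} ((\<lambda>m. 2 * m) ` {m. lam m = lam n})"
      by (intro inj_on_imp_bij_betw inj_onI) simp
    also have "(\<lambda>m. 2 * m) ` {m. lam m = lam n} = a -` {of_real (lam n)}"
    proof (intro equalityI subsetI)
      fix k assume k: "k \<in> a -` {of_real (lam n)}"
      have "even k"
      proof (rule ccontr)
        assume "odd k"
        with k have "- of_real (lam (k div 2)) = (of_real (lam n) :: complex)" by (auto simp: a_def)
        then have "- lam (k div 2) = lam n" by (metis of_real_eq_iff of_real_minus)
        then show False using pos[of n] pos[of "k div 2"] by linarith
      qed
      then show "k \<in> (\<lambda>m. 2 * m) ` {m. lam m = lam n}"
        using k by (auto simp: a_def image_iff elim!: evenE)
    qed (auto simp: a_def)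
    finally show "bij_betw (\<lambda>m. 2 * m) {m. lam m = lam n} (a -` {of_real (lam n)})" .
  qed
  have card_odd: "card (a -` {- of_real (lam n)}) = card {m. lam m = lam n}" for n
  proof (rule bij_betw_same_card[symmetric])
    have "bij_betw (\<lambda>m. 2 * m + 1) {m. lam m = lam n} ((\<lambda>m. 2 * m + 1) ` {m. lam m = lam n})"
      by (intro inj_on_imp_bij_betw inj_onI) simp
    also have "(\<lambda>m. 2 * m + 1) ` {m. lam m = lam n} = a -` {- of_real (lam n)}"
    proof (intro equalityI subsetI)
      fix k assume k: "k \<in> a -` {- of_real (lam n)}"
      have "odd k"
      proof
        assume "even k"
        with k have "of_real (lam (k div 2)) = - (of_real (lam n) :: complex)" by (auto simp: a_def)
        then have "lam (k div 2) = - lam n" by (metis of_real_eq_iff of_real_minus)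
        then show False using pos[of n] pos[of "k div 2"] by linarith
      qed
      then show "k \<in> (\<lambda>m. 2 * m + 1) ` {m. lam m = lam n}"
        using k by (auto simp: a_def image_iff elim!: oddE)
    qed (auto simp: a_def)
    finally show "bij_betw (\<lambda>m. 2 * m + 1) {m. lam m = lam n} (a -` {- of_real (lam n)})" .
  qed
  have "range a = (\<Union>n. {of_real (lam n), - of_real (lam n)})"
  proof (intro equalityI subsetI)
    fix x assume "x \<in> range a"
    then show "x \<in> (\<Union>n. {of_real (lam n), - of_real (lam n)})" by (auto simp: a_def)
  next
    fix x :: complex assume "x \<in> (\<Union>n. {of_real (lam n), - of_real (lam n)})"
    then obtain n where "x = of_real (lam n) \<or> x = - of_real (lam n)" by auto
    then have "x = a (2 * n) \<or> x = a (2 * n + 1)" by (auto simp: a_def)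
    then show "x \<in> range a" by blast
  qed
  then have zero: "W z = 0 \<longleftrightarrow> z \<in> (\<Union>n. {of_real (lam n), - of_real (lam n)})" for z
    unfolding W_def using W.zero[of z] by simp
  show thesis
    by (rule that[of W]) (use lim zero W.holomorphic W.zorder card_even card_odd in \<open>auto simp: W_def\<close>)
qed

text \<open>
  The quotient \<open>E\<close> of \<open>F\<close> by the canonical product \<open>W\<close> is entire and zero-free. It is of minimal type:
  \<open>|W| \<ge> 1\<close> where \<open>Re (z\<^sup>2) \<le> 0\<close>, and in the other region \<open>half_disc_bound\<close> transports the bound for \<open>F\<close> to \<open>E\<close>,
  the hypothesis on the arc being the lower bound for \<open>W\<close> there. A zero-free even function of minimal type
  is constant.
\<close>
theorem hadamard_even_minimal_type2:
  fixes F :: "complex \<Rightarrow> complex" and lam :: "nat \<Rightarrow> real"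
  assumes pos: "\<And>n. lam n > 0" and summ: "summable (\<lambda>n. 1 / (lam n)\<^sup>2)"
    and hol: "F holomorphic_on UNIV" and even: "\<And>z. F (- z) = F z" and F0: "F 0 = 1"
    and zeros: "{z. F z = 0} = (\<Union>n. {of_real (lam n), - of_real (lam n)})"
    and mult: "\<And>n. zorder F (of_real (lam n)) = int (card {m. lam m = lam n})"
    and growth: "minimal_type2 F"
  shows "(\<lambda>M. \<Prod>m<M. 1 - z\<^sup>2 / of_real ((lam m)\<^sup>2)) \<longlonglongrightarrow> F z"
proof -
  obtain W where holW: "W holomorphic_on UNIV"
    and limW: "\<And>z. (\<lambda>M. \<Prod>m<M. 1 - z\<^sup>2 / of_real ((lam m)\<^sup>2)) \<longlonglongrightarrow> W z"
    and zeroW: "\<And>z. W z = 0 \<longleftrightarrow> z \<in> (\<Union>n. {of_real (lam n), - of_real (lam n)})"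
    and ordW: "\<And>n. zorder W (of_real (lam n)) = int (card {m. lam m = lam n})"
      "\<And>n. zorder W (- of_real (lam n)) = int (card {m. lam m = lam n})"
    using symmetric_canonical_product[OF pos summ] by blast
  have evenW: "W (- z) = W z" for z
    using LIMSEQ_unique[OF limW[of z]] limW[of "- z"] by simp
  have W0: "W 0 = 1" using limW[of 0] by (simp add: LIMSEQ_const_iff)
  have "zorder F (- of_real (lam n)) = zorder F (of_real (lam n))" for n
    using zorder_uminus[of F "of_real (lam n)"] even hol
    by (simp add: analytic_on_imp_meromorphic_on holomorphic_on_imp_analytic_at)
  then have ord: "zorder F z = zorder W z" if "W z = 0" for z
    using that mult ordW unfolding zeroW by auto
  obtain E where holE: "E holomorphic_on UNIV" and FEW: "\<And>z. F z = E z * W z"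
    and nzE: "\<And>z. zorder F z = zorder W z \<Longrightarrow> E z \<noteq> 0"
    using entire_quotient[of F 0 W 0] hol holW F0 W0 ord by (metis one_neq_zero order.refl)
  have E_nz: "E z \<noteq> 0" for z
  proof (cases "W z = 0")
    case False
    then have "F z \<noteq> 0" using zeros zeroW by blast
    then show ?thesis using FEW[of z] by auto
  qed (use ord nzE in auto)
  have E_even: "E (- z) = E z" for z
    by (rule even_quotient[OF holE holW _ FEW even evenW, of 0]) (simp add: W0)
  have E0: "E 0 = 1" using FEW[of 0] F0 W0 by simp
  define c where "c m = (lam m)\<^sup>2" for m
  have c: "c m > 0" "summable (\<lambda>m. 1 / c m)" for m using pos[of m] summ by (simp_all add: c_def)
  \<comment> \<open>The product in the variable \<open>w = z\<^sup>2\<close>; the choice of the square root is immaterial as \<open>W\<close> is even.\<close>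
  define G where "G w = W (csqrt w)" for w
  have limG: "(\<lambda>M. \<Prod>m<M. 1 - w / of_real (c m)) \<longlonglongrightarrow> G w" for w
    using limW[of "csqrt w"] by (simp add: G_def c_def)
  have GW: "G (z\<^sup>2) = W z" for z
    using LIMSEQ_unique[OF limG[of "z\<^sup>2"]] limW[of z] by (simp add: c_def)
  have G0: "G 0 = 1" using GW[of 0] W0 by simp
  have left: "1 \<le> cmod (W z)" if "Re (z\<^sup>2) \<le> 0" for z
    using canonical_product_dilation_left[OF c limG that, of 0] by (simp add: G0 GW)
  have bound: "cmod (E z) \<le> exp (\<epsilon> * R) * exp (12 * (cmod z)\<^sup>2 * tail_weight c R)"
    if F_le: "\<And>z. cmod z ^ 2 \<le> R \<Longrightarrow> cmod (F z) \<le> exp (\<epsilon> * R)" and "R > 0"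
      and z: "2 * cmod z ^ 2 \<le> R" for z R \<epsilon>
  proof (cases "Re (z\<^sup>2) \<le> 0")
    case True
    have "(cmod z)\<^sup>2 \<ge> 0" by simp
    then have "(cmod z)\<^sup>2 \<le> R" using z by linarith
    have "cmod (E z) * 1 \<le> cmod (E z) * cmod (W z)"
      using left[OF True] by (intro mult_left_mono) auto
    also have "\<dots> \<le> exp (\<epsilon> * R) * 1" using F_le[OF \<open>(cmod z)\<^sup>2 \<le> R\<close>] by (simp add: FEW norm_mult)
    also have "\<dots> \<le> exp (\<epsilon> * R) * exp (12 * (cmod z)\<^sup>2 * tail_weight c R)"
      using tail_weight_nonneg[OF c \<open>R > 0\<close>] by (intro mult_left_mono) auto
    finally show ?thesis by simp
  next
    case False
    show ?thesis
    proof (rule half_disc_bound)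
      show "real (card {m. c m \<le> 2 * R}) \<le> 2 * R * tail_weight c R"
        by (rule card_below_le_tail_weight[OF c \<open>R > 0\<close>])
      show "cmod (E z) \<le> exp (\<epsilon> * R)" if "Re (z\<^sup>2) = 0" "(cmod z)\<^sup>2 \<le> R" for z
      proof -
        have "cmod (E z) * 1 \<le> cmod (E z) * cmod (W z)"
          using left[of z] that by (intro mult_left_mono) auto
        also have "\<dots> \<le> exp (\<epsilon> * R)" using F_le[OF that(2)] by (simp add: FEW norm_mult)
        finally show ?thesis by simp
      qed
      show "cmod (E z) * cmod (of_real R - z\<^sup>2) ^ card {m. c m \<le> 2 * R}
        \<le> exp (\<epsilon> * R) * cmod (of_real R + z\<^sup>2) ^ card {m. c m \<le> 2 * R} * exp (4 * tail_weight c R * Re (z\<^sup>2))"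
        if "0 \<le> Re (z\<^sup>2)" "(cmod z)\<^sup>2 = R" for z
      proof -
        have nz: "cmod (z\<^sup>2) = R" using that by (simp add: norm_power)
        have "cmod (of_real R - z\<^sup>2) ^ card {m. c m \<le> 2 * R}
          \<le> cmod (W z) * cmod (of_real R + z\<^sup>2) ^ card {m. c m \<le> 2 * R} * exp (4 * tail_weight c R * Re (z\<^sup>2))"
          using canonical_product_dilation_right[OF c limG that(1) nz \<open>R > 0\<close>, of 0] by (simp add: G0 GW)
        then have "cmod (E z) * cmod (of_real R - z\<^sup>2) ^ card {m. c m \<le> 2 * R}
          \<le> cmod (E z) * (cmod (W z) * cmod (of_real R + z\<^sup>2) ^ card {m. c m \<le> 2 * R} * exp (4 * tail_weight c R * Re (z\<^sup>2)))"
          by (intro mult_left_mono) auto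
        also have "\<dots> = cmod (F z) * (cmod (of_real R + z\<^sup>2) ^ card {m. c m \<le> 2 * R} * exp (4 * tail_weight c R * Re (z\<^sup>2)))"
          by (simp add: FEW norm_mult)
        also have "\<dots> \<le> exp (\<epsilon> * R) * (cmod (of_real R + z\<^sup>2) ^ card {m. c m \<le> 2 * R} * exp (4 * tail_weight c R * Re (z\<^sup>2)))"
          using F_le[of z] that by (intro mult_right_mono) auto
        finally show ?thesis by (simp add: mult.assoc)
      qed
      show "E holomorphic_on {z. 0 < Re (z\<^sup>2)}" using holE holomorphic_on_subset by blast
      show "continuous_on {z. 0 \<le> Re (z\<^sup>2)} E"
        using holE holomorphic_on_imp_continuous_on continuous_on_subset by blast
    qed (use False z \<open>R > 0\<close> in auto)
  qed
  have "minimal_type2 E"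
    unfolding minimal_type2_def
  proof (intro allI impI)
    fix \<epsilon> :: real assume "\<epsilon> > 0"
    \<comment> \<open>At \<open>R = 2 r\<^sup>2\<close> the exponent is at most \<open>2 \<delta> r\<^sup>2 + 12 \<delta> r\<^sup>2\<close>.\<close>
    define \<delta> where "\<delta> = \<epsilon> / 14"
    have "\<delta> > 0" using \<open>\<epsilon> > 0\<close> by (simp add: \<delta>_def)
    have ev: "\<forall>\<^sub>F R in at_top. R > 0 \<and> tail_weight c R < \<delta> \<and> (\<forall>z. cmod z ^ 2 \<le> R \<longrightarrow> cmod (F z) \<le> exp (\<delta> * R))"
      using minimal_type2_disc[OF growth hol \<open>\<delta> > 0\<close>] order_tendstoD(2)[OF tail_weight_tendsto_0[OF c] \<open>\<delta> > 0\<close>]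
        eventually_gt_at_top[of 0] by eventually_elim auto
    have lim: "filterlim (\<lambda>r::real. 2 * r\<^sup>2) at_top at_top" by real_asymp
    have "\<forall>\<^sub>F r in at_top. 2 * r\<^sup>2 > 0 \<and> tail_weight c (2 * r\<^sup>2) < \<delta> \<and>
       (\<forall>z. cmod z ^ 2 \<le> 2 * r\<^sup>2 \<longrightarrow> cmod (F z) \<le> exp (\<delta> * (2 * r\<^sup>2)))"
      using lim ev unfolding filterlim_iff by blast
    then show "\<forall>\<^sub>F r in at_top. \<forall>z. cmod z = r \<longrightarrow> cmod (E z) \<le> exp (\<epsilon> * r\<^sup>2)"
    proof eventually_elim
      case (elim r)
      show ?case
      proof (intro allI impI)
        fix z assume z: "cmod z = r"
        have "cmod (E z) \<le> exp (\<delta> * (2 * r\<^sup>2)) * exp (12 * (cmod z)\<^sup>2 * tail_weight c (2 * r\<^sup>2))"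
          by (rule bound) (use elim z in auto)
        also have "\<dots> \<le> exp (\<delta> * (2 * r\<^sup>2)) * exp (12 * (cmod z)\<^sup>2 * \<delta>)"
          using elim by (simp add: mult_left_mono)
        also have "\<dots> = exp (\<epsilon> * r\<^sup>2)" by (simp add: z \<delta>_def flip: exp_add)
        finally show "cmod (E z) \<le> exp (\<epsilon> * r\<^sup>2)" .
      qed
    qed
  qed
  from zero_free_minimal_type2[OF holE E_even E_nz E0 this] have "F z = W z" by (simp add: FEW)
  then show ?thesis using limW by simp
qed

section \<open>Averages of dilations\<close>

lemma continuous_on_entire_dilation:
  assumes "F holomorphic_on UNIV"
  shows "continuous_on UNIV (\<lambda>t::real. F (of_real t * z))"
proof -
  have "continuous_on UNIV (\<lambda>t::real. of_real t * z)"
    by (intro continuous_on_mult_right continuous_on_of_real_id)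
  from continuous_on_compose[OF this, of F] show ?thesis
    using holomorphic_on_imp_continuous_on[OF assms] continuous_on_subset by (auto simp: o_def)
qed

text \<open>
  The argument rests on two features of the Beta weight, finite mass and the absence of atoms. The latter
  makes the mass at \<open>t = 1\<close>, where dilating changes nothing, negligible, and likewise the countable
  set where \<open>F(\<lambda>\<^sub>n t)\<close> vanishes.
\<close>
locale diffuse_unit_measure = finite_measure M for M :: "real measure" +
  assumes measurable_ident: "(\<lambda>t. t) \<in> borel_measurable M"
    and space_unit: "\<And>t. t \<in> space M \<Longrightarrow> 0 \<le> t \<and> t \<le> 1"
    and diffuse: "\<And>x. AE t in M. t \<noteq> x"
begin

lemma integrable_continuous:
  fixes g :: "real \<Rightarrow> 'b :: {banach, second_countable_topology}"
  assumes "continuous_on UNIV g"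
  shows "integrable M g"
proof -
  have "bounded (g ` {0..1})"
    by (intro compact_imp_bounded compact_continuous_image continuous_on_subset[OF assms]) auto
  then obtain B where B: "\<And>t. t \<in> {0..1} \<Longrightarrow> norm (g t) \<le> B"
    unfolding bounded_iff by blast
  have "g \<in> borel_measurable borel" using assms by (rule borel_measurable_continuous_onI)
  from measurable_compose[OF measurable_ident this]
  show ?thesis
    by (intro integrable_const_bound[of _ B]) (auto intro!: AE_I2 B dest: space_unit)
qed

definition dilation_integral :: "(real \<Rightarrow> complex) \<Rightarrow> (complex \<Rightarrow> complex) \<Rightarrow> complex \<Rightarrow> complex" where
  "dilation_integral g F z = (\<integral>t. g t * F (of_real t * z) \<partial>M)"

text \<open>
  Integrating the power series of \<open>F\<close> term by term multiplies its coefficients by the moments of \<open>g\<close>. This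
  yields holomorphy and the Taylor coefficients at 0 together.
\<close>
lemma dilation_integral_sums:
  assumes F: "F holomorphic_on UNIV" and g: "continuous_on UNIV g"
  shows "(\<lambda>k. (\<integral>t. g t * of_real (t ^ k) \<partial>M) * ((deriv ^^ k) F 0 / fact k) * z ^ k)
    sums dilation_integral g F z"
proof -
  define a where "a k = (deriv ^^ k) F 0 / fact k" for k
  have a: "(\<lambda>k. a k * w ^ k) sums F w" for w
    using holomorphic_power_series[of F 0 "cmod w + 1" w] F holomorphic_on_subset
    by (auto simp: a_def)
  have int: "integrable M (\<lambda>t. g t * of_real (t ^ k))" for k
    by (intro integrable_continuous continuous_intros g)
  have abs_a: "summable (\<lambda>k. cmod (a k * z ^ k))"
  proof (rule powser_insidea)
    show "summable (\<lambda>k. a k * of_real (cmod z + 1) ^ k)" using a by (rule sums_summable)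
    show "cmod z < cmod (of_real (cmod z + 1))" unfolding norm_of_real by simp
  qed
  have norm_le: "cmod (g t * of_real (t ^ k) * (a k * z ^ k)) \<le> cmod (g t) * cmod (a k * z ^ k)"
    if "t \<in> space M" for t k
  proof -
    have "cmod (of_real (t ^ k)) \<le> 1" using space_unit[OF that] unfolding norm_of_real by (simp add: power_le_one)
    then have "cmod (g t) * cmod (of_real (t ^ k)) * cmod (a k * z ^ k) \<le> cmod (g t) * 1 * cmod (a k * z ^ k)"
      by (intro mult_right_mono mult_left_mono) auto
    then show ?thesis unfolding norm_mult by simp
  qed
  have gint: "integrable M (\<lambda>t. cmod (g t))" by (intro integrable_continuous continuous_intros g)
  have "(\<lambda>k. \<integral>t. g t * of_real (t ^ k) * (a k * z ^ k) \<partial>M) sums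
    (\<integral>t. (\<Sum>k. g t * of_real (t ^ k) * (a k * z ^ k)) \<partial>M)"
  proof (rule sums_integral)
    show "integrable M (\<lambda>t. g t * of_real (t ^ k) * (a k * z ^ k))" for k
      using int by (intro integrable_mult_left) auto
    show "AE t in M. summable (\<lambda>k. cmod (g t * of_real (t ^ k) * (a k * z ^ k)))"
    proof (rule AE_I2)
      fix t assume "t \<in> space M"
      then show "summable (\<lambda>k. cmod (g t * of_real (t ^ k) * (a k * z ^ k)))"
        by (intro summable_comparison_test'[OF summable_mult[OF abs_a, of "cmod (g t)"], of 0])
           (simp only: real_norm_def abs_norm_cancel norm_le)
    qed
    show "summable (\<lambda>k. \<integral>t. cmod (g t * of_real (t ^ k) * (a k * z ^ k)) \<partial>M)"
    proof (rule summable_comparison_test'[OF summable_mult[OF abs_a, of "\<integral>t. cmod (g t) \<partial>M"], of 0])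
      fix k :: nat
      have "(\<integral>t. cmod (g t * of_real (t ^ k) * (a k * z ^ k)) \<partial>M) \<le> (\<integral>t. cmod (g t) * cmod (a k * z ^ k) \<partial>M)"
        using int by (intro integral_mono integrable_norm integrable_mult_left gint norm_le) auto
      moreover have "0 \<le> (\<integral>t. cmod (g t * of_real (t ^ k) * (a k * z ^ k)) \<partial>M)"
        by (rule Bochner_Integration.integral_nonneg) simp
      ultimately show "norm (\<integral>t. cmod (g t * of_real (t ^ k) * (a k * z ^ k)) \<partial>M) \<le> (\<integral>t. cmod (g t) \<partial>M) * cmod (a k * z ^ k)"
        unfolding real_norm_def integral_mult_left_zero by linarith
    qed
  qed
  also have "(\<integral>t. (\<Sum>k. g t * of_real (t ^ k) * (a k * z ^ k)) \<partial>M) = dilation_integral g F z"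
    unfolding dilation_integral_def
  proof (rule Bochner_Integration.integral_cong[OF refl])
    fix t
    have "(\<lambda>k. g t * (a k * (of_real t * z) ^ k)) sums (g t * F (of_real t * z))"
      by (rule sums_mult[OF a])
    then show "(\<Sum>k. g t * of_real (t ^ k) * (a k * z ^ k)) = g t * F (of_real t * z)"
      by (intro sums_unique[symmetric]) (simp add: power_mult_distrib mult.assoc mult.left_commute)
  qed
  finally show ?thesis unfolding integral_mult_left_zero unfolding a_def[symmetric] mult.assoc .
qed

lemma dilation_integral_holomorphic:
  assumes "F holomorphic_on UNIV" "continuous_on UNIV g"
  shows "dilation_integral g F holomorphic_on UNIV"
proof -
  have "dilation_integral g F holomorphic_on ball 0 r" for r
  proof (rule power_series_holomorphic)
    show "(\<lambda>k. (\<integral>t. g t * of_real (t ^ k) \<partial>M) * ((deriv ^^ k) F 0 / fact k) * (w - 0) ^ k)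
      sums dilation_integral g F w" for w
      using dilation_integral_sums[OF assms, of w] by (simp only: diff_zero)
  qed
  then have "dilation_integral g F field_differentiable at z" for z
    by (rule holomorphic_on_imp_differentiable_at[of _ "ball 0 (cmod z + 1)"]) auto
  then show ?thesis by (simp add: holomorphic_on_def)
qed

lemma dilation_integral_fps:
  assumes "F holomorphic_on UNIV" "continuous_on UNIV g"
  shows "dilation_integral g F has_fps_expansion
    Abs_fps (\<lambda>k. (\<integral>t. g t * of_real (t ^ k) \<partial>M) * ((deriv ^^ k) F 0 / fact k))"
  by (rule has_fps_expansionI, rule always_eventually, rule allI, unfold fps_nth_Abs_fps)
     (rule dilation_integral_sums[OF assms])

lemma dilation_integral_even:
  assumes "\<And>z. F (- z) = F z"
  shows "dilation_integral g F (- z) = dilation_integral g F z"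
  by (simp add: dilation_integral_def assms)

lemma cmod_dilation_integral_le:
  assumes F: "F holomorphic_on UNIV" and g: "continuous_on UNIV g"
    and bound: "\<And>t. t \<in> {0..1} \<Longrightarrow> cmod (g t) \<le> C"
  shows "cmod (dilation_integral g F z) \<le> C * (\<integral>t. cmod (F (of_real t * z)) \<partial>M)"
proof -
  have cF: "continuous_on UNIV (\<lambda>t. F (of_real t * z))"
    by (rule continuous_on_entire_dilation[OF F])
  have "cmod (dilation_integral g F z) \<le> (\<integral>t. cmod (g t * F (of_real t * z)) \<partial>M)"
    unfolding dilation_integral_def by (rule integral_norm_bound)
  also have "\<dots> \<le> (\<integral>t. C * cmod (F (of_real t * z)) \<partial>M)"
  proof (rule integral_mono)
    show "integrable M (\<lambda>t. cmod (g t * F (of_real t * z)))" "integrable M (\<lambda>t. C * cmod (F (of_real t * z)))"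
      by (intro integrable_continuous continuous_intros g cF)+
    show "cmod (g t * F (of_real t * z)) \<le> C * cmod (F (of_real t * z))" if "t \<in> space M" for t
      using space_unit[OF that] bound[of t] by (simp add: norm_mult mult_right_mono)
  qed
  finally show ?thesis by simp
qed

end

section \<open>Functions vanishing at all zeros of the product\<close>

lemma cmod_one_plus_ge:
  assumes "Re w \<ge> 0" shows "1 + cmod w \<le> 2 * cmod (1 + w)"
proof -
  have "1 \<le> cmod (1 + w)" using assms complex_Re_le_cmod[of "1 + w"] by simp
  moreover have "cmod w \<le> cmod (1 + w)"
    by (rule power2_le_imp_le) (unfold cmod_power2, use assms in \<open>simp_all add: power2_eq_square algebra_simps\<close>)
  ultimately show ?thesis by linarith
qed

locale canonical_even_product = diffuse_unit_measure M for M :: "real measure" +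
  fixes F :: "complex \<Rightarrow> complex" and lam :: "nat \<Rightarrow> real"
  assumes holF: "F holomorphic_on UNIV"
    and lam_pos: "\<And>n. lam n > 0" and summable_lam: "summable (\<lambda>n. 1 / (lam n)\<^sup>2)"
    and product: "\<And>z. (\<lambda>N. \<Prod>m<N. 1 - z\<^sup>2 / of_real ((lam m)\<^sup>2)) \<longlonglongrightarrow> F z"
    and zerosF: "{z. F z = 0} = (\<Union>n. {of_real (lam n), - of_real (lam n)})"
    and multF: "\<And>n. zorder F (of_real (lam n)) = int (card {m. lam m = lam n})"
begin

definition mean_modulus :: "complex \<Rightarrow> real" where
  "mean_modulus z = (\<integral>t. cmod (F (of_real t * z)) \<partial>M)"

lemma mean_modulus_nonneg: "0 \<le> mean_modulus z"
  unfolding mean_modulus_def by (rule Bochner_Integration.integral_nonneg) simp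

lemma F_0: "F 0 = 1"
  using product[of 0] by (simp add: LIMSEQ_const_iff)

lemma F_even: "F (- z) = F z"
  using LIMSEQ_unique[OF product[of z]] product[of "- z"] by simp

lemma F_real: "Im (F (of_real x)) = 0"
proof -
  have "(\<lambda>N. Im (\<Prod>m<N. 1 - (of_real x)\<^sup>2 / of_real ((lam m)\<^sup>2))) \<longlonglongrightarrow> Im (F (of_real x))"
    by (intro tendsto_Im product)
  moreover have "Im (\<Prod>m<N. 1 - (of_real x)\<^sup>2 / of_real ((lam m)\<^sup>2)) = 0" for N
  proof -
    have "(\<Prod>m<N. 1 - (of_real x)\<^sup>2 / of_real ((lam m)\<^sup>2)) = (of_real (\<Prod>m<N. 1 - x\<^sup>2 / (lam m)\<^sup>2) :: complex)"
      by simp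
    then show ?thesis by (metis Im_complex_of_real)
  qed
  ultimately show ?thesis by (simp add: LIMSEQ_const_iff)
qed

text \<open>
  The rigidity principle. The quotient \<open>Q = N / F\<close> is estimated on \<open>Re (z\<^sup>2) \<le> 0\<close> by the dilation inequality
  alone. On \<open>Re (z\<^sup>2) \<ge> 0\<close> it is divided by \<open>1 + z\<^sup>2\<close>, which is comparable to \<open>1 + |z|\<^sup>2\<close> there, to become
  bounded on the two lines \<open>Re (z\<^sup>2) = 0\<close>; then \<open>half_disc_bound\<close> with \<open>R \<rightarrow> \<infinity>\<close> shows that it is bounded in
  between. Dominated convergence supplies \<open>Q = o(|z|\<^sup>2)\<close> on the imaginary axis.
\<close>
lemma multiple_of_F_if_vanishes_at_zeros:
  assumes inj: "inj lam" and holN: "N holomorphic_on UNIV" and evenN: "\<And>z. N (- z) = N z"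
    and zeroN: "\<And>n. N (of_real (lam n)) = 0"
    and bound: "\<And>z. cmod (N z) \<le> C * (1 + (cmod z)\<^sup>2) * mean_modulus z"
  shows "N z = N 0 * F z"
proof (cases "\<forall>z. N z = 0")
  case False
  then obtain b where b: "N b \<noteq> 0" by blast
  define c where "c m = (lam m)\<^sup>2" for m
  have c: "c m > 0" "summable (\<lambda>m. 1 / c m)" for m using lam_pos[of m] summable_lam by (simp_all add: c_def)
  define G where "G w = F (csqrt w)" for w
  have limG: "(\<lambda>N. \<Prod>m<N. 1 - w / of_real (c m)) \<longlonglongrightarrow> G w" for w
    using product[of "csqrt w"] by (simp add: G_def c_def)
  have GF: "G (z\<^sup>2) = F z" for z
    using LIMSEQ_unique[OF limG[of "z\<^sup>2"]] product[of z] by (simp add: c_def)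
  have G0: "G 0 = 1" using GF[of 0] F_0 by simp
  have dil: "F (of_real t * z) = G (of_real (t\<^sup>2) * z\<^sup>2)" for t z
    using GF[of "of_real t * z"] by (simp add: power_mult_distrib)
  define B where "B = measure M (space M)"
  have B: "B \<ge> 0" by (simp add: B_def)
  have contF: "continuous_on UNIV (\<lambda>t::real. F (of_real t * z))" for z
    by (rule continuous_on_entire_dilation[OF holF])
  have intF: "integrable M (\<lambda>t. cmod (F (of_real t * z)))" for z
    by (intro integrable_continuous continuous_on_norm contF)
  have unit: "0 \<le> t\<^sup>2 \<and> t\<^sup>2 \<le> 1" if "t \<in> space M" for t
    using space_unit[OF that] by (simp add: power_le_one)
  have C: "C \<ge> 0"
  proof -
    have "0 < cmod (N b)" using b by simp
    also note bound[of b]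
    finally have "C * (1 + (cmod b)\<^sup>2) * mean_modulus b > 0" .
    then show ?thesis using mean_modulus_nonneg[of b]
      by (smt (verit) mult_nonneg_nonneg mult_nonpos_nonneg zero_le_power2)
  qed
  have left: "cmod (F (of_real t * z)) \<le> cmod (F z)" if "Re (z\<^sup>2) \<le> 0" "t \<in> space M" for t z
    unfolding dil using canonical_product_dilation_left[OF c limG that(1)] unit[OF that(2)] GF by metis
  have F_ge1: "1 \<le> cmod (F z)" if "Re (z\<^sup>2) \<le> 0" for z
    using canonical_product_dilation_left[OF c limG that, of 0] by (simp add: G0 GF)
  have mm_left: "mean_modulus z \<le> B * cmod (F z)" if "Re (z\<^sup>2) \<le> 0" for z
  proof -
    have "mean_modulus z \<le> (\<integral>t. cmod (F z) \<partial>M)"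
      unfolding mean_modulus_def by (rule integral_mono) (use left[OF that] intF in auto)
    then show ?thesis by (simp add: B_def)
  qed
  have "zorder F z \<le> zorder N z" if "F z = 0" for z
  proof -
    have ana: "F analytic_on {w}" "N analytic_on {w}" for w
      using holF holN by (auto intro: holomorphic_on_imp_analytic_at)
    have "z \<in> {z. F z = 0}" using that by simp
    then obtain n where n: "z = of_real (lam n) \<or> z = - of_real (lam n)" unfolding zerosF by auto
    have "zorder F (- of_real (lam n)) = zorder F (of_real (lam n))"
      using zorder_uminus[of F "of_real (lam n)"] F_even ana by (simp add: analytic_on_imp_meromorphic_on)
    moreover have "{m. lam m = lam n} = {n}" using inj by (auto dest: injD)
    ultimately have "zorder F z = 1" using n multF[of n] by auto
    moreover have "N z = 0" using n zeroN evenN by auto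
    moreover have "\<exists>\<^sub>F w in at z. N w \<noteq> 0"
      using non_zero_neighbour_alt[OF holN open_UNIV connected_UNIV _ _ b, of z]
      by (intro eventually_frequently[OF at_neq_bot]) simp
    ultimately show ?thesis using zorder_pos_iff'[of N z] ana by fastforce
  qed
  then obtain Q where holQ: "Q holomorphic_on UNIV" and NQF: "\<And>z. N z = Q z * F z"
    using entire_quotient[of N b F 0] holN b holF F_0 by (metis one_neq_zero)
  have evenQ: "Q (- z) = Q z" for z
    by (rule even_quotient[OF holQ holF _ NQF evenN F_even, of 0]) (simp add: F_0)
  have Q_left: "cmod (Q z) \<le> C * B * (1 + (cmod z)\<^sup>2)" if "Re (z\<^sup>2) \<le> 0" for z
  proof -
    have "cmod (Q z) * cmod (F z) \<le> C * (1 + (cmod z)\<^sup>2) * mean_modulus z"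
      using bound[of z] by (simp add: NQF norm_mult)
    also have "\<dots> \<le> C * (1 + (cmod z)\<^sup>2) * (B * cmod (F z))"
      using mm_left[OF that] C by (intro mult_left_mono) auto
    finally have "cmod (Q z) * cmod (F z) \<le> C * B * (1 + (cmod z)\<^sup>2) * cmod (F z)"
      by (simp add: mult_ac)
    moreover have "cmod (F z) > 0" using F_ge1[OF that] by linarith
    ultimately show ?thesis by simp
  qed
  define K where "K = 2 * C * B"
  have K: "K \<ge> 0" using C B by (simp add: K_def)
  define q where "q z = Q z / (1 + z\<^sup>2)" for z
  have one_plus: "(1 + (cmod z)\<^sup>2) \<le> 2 * cmod (1 + z\<^sup>2)" "1 + z\<^sup>2 \<noteq> 0" if "0 \<le> Re (z\<^sup>2)" for z
  proof -
    show *: "(1 + (cmod z)\<^sup>2) \<le> 2 * cmod (1 + z\<^sup>2)" using cmod_one_plus_ge[OF that] by (simp add: norm_power)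
    have "0 < 1 + (cmod z)\<^sup>2" by (simp add: add_pos_nonneg)
    with * show "1 + z\<^sup>2 \<noteq> 0" by (metis mult_zero_right norm_zero not_less)
  qed
  have q_le: "cmod (q z) * x \<le> K * y"
    if "0 \<le> Re (z\<^sup>2)" "cmod (Q z) * x \<le> C * B * (1 + (cmod z)\<^sup>2) * y" "y \<ge> 0" for z x y
  proof -
    have "C * B * (1 + (cmod z)\<^sup>2) * y \<le> C * B * (2 * cmod (1 + z\<^sup>2)) * y"
      using one_plus(1)[OF that(1)] C B that(3) by (intro mult_right_mono mult_left_mono) auto
    with that(2) have "cmod (Q z) * x \<le> K * y * cmod (1 + z\<^sup>2)" by (simp add: K_def mult_ac)
    then show ?thesis using one_plus(2)[OF that(1)] by (simp add: q_def norm_divide divide_le_eq)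
  qed
  have q_right: "cmod (q z) \<le> K * exp (12 * (cmod z)\<^sup>2 * tail_weight c R)"
    if "R > 0" and z: "0 \<le> Re (z\<^sup>2)" "2 * cmod z ^ 2 \<le> R" for z R
  proof (rule half_disc_bound)
    show "real (card {m. c m \<le> 2 * R}) \<le> 2 * R * tail_weight c R"
      by (rule card_below_le_tail_weight[OF c \<open>R > 0\<close>])
    show "cmod (q z) \<le> K" if "Re (z\<^sup>2) = 0" for z
      using q_le[of z 1 1] Q_left[of z] that by simp
    show "cmod (q z) * cmod (of_real R - z\<^sup>2) ^ card {m. c m \<le> 2 * R}
      \<le> K * cmod (of_real R + z\<^sup>2) ^ card {m. c m \<le> 2 * R} * exp (4 * tail_weight c R * Re (z\<^sup>2))"
      if "0 \<le> Re (z\<^sup>2)" "(cmod z)\<^sup>2 = R" for z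
    proof -
      define u where "u = cmod (of_real R - z\<^sup>2) ^ card {m. c m \<le> 2 * R}"
      define v where "v = cmod (of_real R + z\<^sup>2) ^ card {m. c m \<le> 2 * R} * exp (4 * tail_weight c R * Re (z\<^sup>2))"
      have u: "u \<ge> 0" and v: "v \<ge> 0" by (simp_all add: u_def v_def)
      have nz: "cmod (z\<^sup>2) = R" using that by (simp add: norm_power)
      have ratio: "cmod (G (of_real s * z\<^sup>2)) * u \<le> cmod (F z) * v" if "0 \<le> s" "s \<le> 1" for s
        using canonical_product_dilation_right[OF c limG \<open>0 \<le> Re (z\<^sup>2)\<close> nz \<open>R > 0\<close> that]
        by (simp add: u_def v_def GF mult.assoc)
      have "cmod (Q z) * u \<le> C * B * (1 + (cmod z)\<^sup>2) * v"
      proof (cases "F z = 0")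
        case True
        \<comment> \<open>The inequality for \<open>s = 0\<close> reads \<open>u \<le> |F z| * v\<close>.\<close>
        then have "u = 0" using ratio[of 0] u by (simp add: G0)
        then show ?thesis using C B v by simp
      next
        case False
        have "mean_modulus z * u = (\<integral>t. cmod (F (of_real t * z)) * u \<partial>M)"
          by (simp add: mean_modulus_def)
        also have "\<dots> \<le> (\<integral>t. cmod (F z) * v \<partial>M)"
        proof (rule integral_mono)
          show "cmod (F (of_real t * z)) * u \<le> cmod (F z) * v" if "t \<in> space M" for t
            unfolding dil using ratio unit[OF that] by blast
        qed (use intF in auto)
        also have "\<dots> = B * (cmod (F z) * v)" by (simp add: B_def)
        finally have mm: "mean_modulus z * u \<le> B * (cmod (F z) * v)" .
        have "cmod (Q z) * u * cmod (F z) = cmod (N z) * u" by (simp add: NQF norm_mult)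
        also have "\<dots> \<le> C * (1 + (cmod z)\<^sup>2) * mean_modulus z * u"
          using bound[of z] u by (intro mult_right_mono) auto
        also have "\<dots> \<le> C * (1 + (cmod z)\<^sup>2) * (B * (cmod (F z) * v))"
          unfolding mult.assoc[of _ "mean_modulus z" u] using mm C by (intro mult_left_mono) auto
        also have "\<dots> = C * B * (1 + (cmod z)\<^sup>2) * v * cmod (F z)" by simp
        finally show ?thesis using False by simp
      qed
      from q_le[OF that(1) this v] show ?thesis by (simp add: u_def v_def mult.assoc)
    qed
    show "q holomorphic_on {z. 0 < Re (z\<^sup>2)}"
      unfolding q_def using one_plus(2)
      by (intro holomorphic_intros holomorphic_on_subset[OF holQ]) auto
    have "continuous_on {z. 0 \<le> Re (z\<^sup>2)} Q"
      using holQ holomorphic_on_imp_continuous_on continuous_on_subset by blast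
    then show "continuous_on {z. 0 \<le> Re (z\<^sup>2)} q"
      unfolding q_def using one_plus(2) by (intro continuous_on_divide continuous_intros) auto
  qed (use that K in auto)
  have Q_right: "cmod (Q z) \<le> K * (1 + (cmod z)\<^sup>2)" if "0 \<le> Re (z\<^sup>2)" for z
  proof -
    have "cmod (q z) \<le> K"
    proof (rule tendsto_lowerbound)
      have "((\<lambda>R. K * exp (12 * (cmod z)\<^sup>2 * tail_weight c R)) \<longlongrightarrow> K * exp (12 * (cmod z)\<^sup>2 * 0)) at_top"
        by (intro tendsto_intros tail_weight_tendsto_0[OF c])
      then show "((\<lambda>R. K * exp (12 * (cmod z)\<^sup>2 * tail_weight c R)) \<longlongrightarrow> K) at_top" by simp
      show "\<forall>\<^sub>F R in at_top. cmod (q z) \<le> K * exp (12 * (cmod z)\<^sup>2 * tail_weight c R)"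
        using eventually_gt_at_top[of 0] eventually_ge_at_top[of "2 * (cmod z)\<^sup>2"]
        by eventually_elim (rule q_right[OF _ that])
    qed simp
    then have "cmod (Q z) \<le> K * cmod (1 + z\<^sup>2)"
      using one_plus(2)[OF that] by (simp add: q_def norm_divide divide_le_eq)
    also have "cmod (1 + z\<^sup>2) \<le> 1 + (cmod z)\<^sup>2"
      using norm_triangle_ineq[of 1 "z\<^sup>2"] by (simp add: norm_power)
    finally show ?thesis using K by (simp add: mult_left_mono)
  qed
  have quad: "cmod (Q z) \<le> (2 * K) * (cmod z)\<^sup>2" if "1 \<le> cmod z" for z
  proof -
    have "cmod (Q z) \<le> K * (1 + (cmod z)\<^sup>2)"
    proof (cases "0 \<le> Re (z\<^sup>2)")
      case False
      then have "cmod (Q z) \<le> C * B * (1 + (cmod z)\<^sup>2)" using Q_left[of z] by simp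
      also have "\<dots> \<le> K * (1 + (cmod z)\<^sup>2)" using C B by (intro mult_right_mono) (auto simp: K_def)
      finally show ?thesis .
    qed (use Q_right in auto)
    also have "\<dots> \<le> K * (2 * (cmod z)\<^sup>2)"
      using that K by (intro mult_left_mono) (auto simp: one_le_power)
    finally show ?thesis by simp
  qed
  have little: "((\<lambda>y::real. Q (\<i> * of_real y) / of_real (y\<^sup>2)) \<longlongrightarrow> 0) at_top"
  proof (rule Lim_null_comparison)
    define r where "r y t = cmod (F (of_real t * (\<i> * of_real y))) / cmod (F (\<i> * of_real y))" for y t :: real
    have sq: "(\<i> * of_real y)\<^sup>2 = - (of_real (y\<^sup>2) :: complex)" for y by (simp add: power_mult_distrib)
    have Re_sq: "Re ((\<i> * of_real y)\<^sup>2) \<le> 0" for y unfolding sq by simp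
    have "((\<lambda>y. \<integral>t. r y t \<partial>M) \<longlongrightarrow> (\<integral>t. 0 \<partial>M)) at_top"
    proof (rule integral_dominated_convergence_at_top)
      show "integrable M (\<lambda>t. 1 :: real)" by simp
      have "r y \<in> borel_measurable M" for y
        using intF[of "\<i> * of_real y"] unfolding r_def[abs_def] by simp
      then show "r y \<in> borel_measurable M" for y .
      show "\<forall>\<^sub>F y in at_top. AE t in M. norm (r y t) \<le> 1"
      proof (rule always_eventually, rule allI, rule AE_I2)
        fix y t assume "t \<in> space M"
        then show "norm (r y t) \<le> 1"
          using left[OF Re_sq, of t y] F_ge1[OF Re_sq, of y] by (simp add: r_def divide_le_eq_1)
      qed
      show "AE t in M. ((\<lambda>y. r y t) \<longlongrightarrow> 0) at_top"
        using diffuse[of 1]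
      proof (rule AE_mp, intro AE_I2 impI)
        fix t assume t: "t \<in> space M" "t \<noteq> 1"
        then have "t\<^sup>2 < 1" using space_unit[OF t(1)] by (simp add: power_strict_mono abs_square_less_1)
        have lim: "filterlim (\<lambda>y::real. y\<^sup>2) at_top at_top" by real_asymp
        have "r y t = cmod (G (- of_real (t\<^sup>2 * y\<^sup>2))) / cmod (G (- of_real (y\<^sup>2)))" for y
          unfolding r_def dil sq GF[of "\<i> * of_real y", symmetric] by simp
        then show "((\<lambda>y. r y t) \<longlongrightarrow> 0) at_top"
          using filterlim_compose[OF canonical_product_dilation_negative_axis_tendsto_0[OF c limG _ \<open>t\<^sup>2 < 1\<close>] lim] by simp
      qed
    qed simp_all
    then have "((\<lambda>y. 2 * C * (\<integral>t. r y t \<partial>M)) \<longlongrightarrow> 2 * C * 0) at_top"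
      by (intro tendsto_intros) simp
    then show "((\<lambda>y. 2 * C * (\<integral>t. r y t \<partial>M)) \<longlongrightarrow> 0) at_top" by simp
    show "\<forall>\<^sub>F y in at_top. norm (Q (\<i> * of_real y) / of_real (y\<^sup>2)) \<le> 2 * C * (\<integral>t. r y t \<partial>M)"
      using eventually_ge_at_top[of 1]
    proof eventually_elim
      case (elim y)
      let ?z = "\<i> * of_real y :: complex"
      have Fpos: "cmod (F ?z) > 0" using F_ge1[OF Re_sq, of y] by linarith
      have norm_z: "(cmod ?z)\<^sup>2 = y\<^sup>2" by (simp add: norm_mult)
      have y2: "1 \<le> y\<^sup>2" using elim by (simp add: one_le_power)
      have mm: "(\<integral>t. r y t \<partial>M) = mean_modulus ?z / cmod (F ?z)"
        unfolding r_def mean_modulus_def by simp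
      have "cmod (Q ?z) * cmod (F ?z) \<le> C * (1 + y\<^sup>2) * mean_modulus ?z"
        using bound[of ?z] unfolding norm_z by (simp add: NQF norm_mult)
      also have "\<dots> \<le> C * (2 * y\<^sup>2) * mean_modulus ?z"
        using y2 C mean_modulus_nonneg by (intro mult_right_mono mult_left_mono) auto
      finally have "cmod (Q ?z) \<le> 2 * C * (mean_modulus ?z / cmod (F ?z)) * y\<^sup>2"
        using Fpos by (simp add: field_simps)
      then show ?case using y2 elim unfolding mm by (simp add: norm_divide norm_power divide_le_eq)
    qed
  qed
  from even_entire_constI[OF holQ evenQ quad little] have "Q z = Q 0" .
  then show ?thesis using NQF[of z] NQF[of 0] F_0 by simp
qed simp

text \<open>
  If \<open>\<lambda>\<^sub>n = \<lambda>\<^sub>m\<close> for some \<open>n \<noteq> m\<close>, orthogonality makes the integral of the square of the real function \<open>F(\<lambda>\<^sub>n t)\<close>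
  vanish, although that function has only countably many zeros.
\<close>
lemma orthogonal_imp_distinct:
  assumes nonzero: "measure M (space M) \<noteq> 0"
    and orth: "\<And>n m. n \<noteq> m \<Longrightarrow> (\<integral>t. F (of_real (lam n * t)) * F (of_real (lam m * t)) \<partial>M) = 0"
  shows "inj lam"
proof (rule injI, rule ccontr)
  fix n m assume eq: "lam n = lam m" and "n \<noteq> m"
  define h where "h t = Re (F (of_real (lam n * t)))" for t
  have Fh: "F (of_real (lam n * t)) = of_real (h t)" for t
    using F_real[of "lam n * t"] by (simp add: h_def complex_eq_iff)
  have "continuous_on UNIV (\<lambda>t::real. F (of_real t * of_real (lam n)))"
    by (rule continuous_on_entire_dilation[OF holF])
  then have cont: "continuous_on UNIV h"
    unfolding h_def by (intro continuous_on_Re) (simp add: mult.commute)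
  have "complex_of_real (\<integral>t. (h t)\<^sup>2 \<partial>M) = (\<integral>t. F (of_real (lam n * t)) * F (of_real (lam m * t)) \<partial>M)"
    unfolding eq[symmetric] Fh by (simp add: power2_eq_square flip: of_real_mult)
  also have "\<dots> = 0" by (rule orth[OF \<open>n \<noteq> m\<close>])
  finally have int0: "(\<integral>t. (h t)\<^sup>2 \<partial>M) = 0" by (simp only: of_real_eq_0_iff)
  have "integrable M (\<lambda>t. (h t)\<^sup>2)"
    by (intro integrable_continuous continuous_on_power cont)
  with int0 have "AE t in M. (h t)\<^sup>2 = 0"
    by (subst (asm) integral_nonneg_eq_0_iff_AE) auto
  moreover have "AE t in M. \<forall>k. t \<noteq> lam k / lam n \<and> t \<noteq> - lam k / lam n"
    unfolding AE_all_countable using diffuse by (auto intro: AE_conjI)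
  ultimately have "AE t in M. False"
  proof eventually_elim
    case (elim t)
    then have "F (of_real (lam n * t)) = 0" unfolding Fh by simp
    then have "of_real (lam n * t) \<in> {z. F z = 0}" by simp
    then obtain k where "complex_of_real (lam n * t) = of_real (lam k) \<or> complex_of_real (lam n * t) = of_real (- lam k)"
      unfolding zerosF by auto
    then have "lam n * t = lam k \<or> lam n * t = - lam k" by (simp only: of_real_eq_iff)
    then have "t = lam k / lam n \<or> t = - lam k / lam n"
      using lam_pos[of n] by (auto simp: field_simps)
    then show ?case using elim by blast
  qed
  then have "emeasure M (space M) = 0" by (simp add: ae_filter_eq_bot_iff[symmetric] trivial_limit_def)
  then show False using nonzero by (simp add: measure_def)
qed

section \<open>The integral equation\<close>

text \<open>
  For each \<open>n\<close>, orthogonality gives all zeros except \<open>\<plusminus>\<lambda>\<^sub>n\<close> to \<open>H(w) = \<integral> F(t w) F(t \<lambda>\<^sub>n) \<partial>M\<close>, and the factor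
  \<open>w\<^sup>2 - \<lambda>\<^sub>n\<^sup>2\<close> supplies these two. In the resulting identity \<open>(w\<^sup>2 - \<lambda>\<^sub>n\<^sup>2) H(w) = - \<lambda>\<^sub>n\<^sup>2 H(0) F(w)\<close> the coefficients
  of \<open>w\<^sup>2\<close> involve only \<open>I(\<lambda>\<^sub>n)\<close>, \<open>J(\<lambda>\<^sub>n)\<close> and \<open>a\<close>.
\<close>
theorem dilation_equation:
  assumes nonzero: "measure M (space M) \<noteq> 0"
    and orth: "\<And>n m. n \<noteq> m \<Longrightarrow> (\<integral>t. F (of_real (lam n * t)) * F (of_real (lam m * t)) \<partial>M) = 0"
  defines "a \<equiv> deriv (deriv F) 0"
  shows "a * z\<^sup>2 * dilation_integral (\<lambda>t. of_real (t ^ 2)) F z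
     = (a * z\<^sup>2 + 2) * dilation_integral (\<lambda>t. 1) F z - 2 * of_real (measure M (space M)) * F z"
proof -
  have inj: "inj lam" by (rule orthogonal_imp_distinct[OF nonzero orth])
  define I where "I = dilation_integral (\<lambda>t. 1) F"
  define J where "J = dilation_integral (\<lambda>t. of_real (t ^ 2)) F"
  have cont_sq: "continuous_on UNIV (\<lambda>t::real. of_real (t ^ 2) :: complex)"
    by (intro continuous_intros)
  have at_zero: "(a * (of_real (lam n))\<^sup>2 + 2) * I (of_real (lam n)) = a * (of_real (lam n))\<^sup>2 * J (of_real (lam n))" for n
  proof -
    define l where "l = complex_of_real (lam n)"
    define g where "g t = F (of_real t * l)" for t
    have contg: "continuous_on UNIV g"
      unfolding g_def by (rule continuous_on_entire_dilation[OF holF])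
    define H where "H = dilation_integral g F"
    define N where "N w = (w\<^sup>2 - l\<^sup>2) * H w" for w
    have holH: "H holomorphic_on UNIV" unfolding H_def by (rule dilation_integral_holomorphic[OF holF contg])
    have evenH: "H (- w) = H w" for w unfolding H_def by (rule dilation_integral_even) (rule F_even)
    have "bounded (g ` {0..1})"
      by (intro compact_imp_bounded compact_continuous_image continuous_on_subset[OF contg]) auto
    then obtain C where C: "\<And>t. t \<in> {0..1} \<Longrightarrow> cmod (g t) \<le> C" unfolding bounded_iff by blast
    have N_eq: "N w = N 0 * F w" for w
    proof (rule multiple_of_F_if_vanishes_at_zeros[OF inj])
      show "N holomorphic_on UNIV" unfolding N_def by (intro holomorphic_intros holH)
      show "N (- w) = N w" for w by (simp add: N_def evenH)
      show "N (of_real (lam m)) = 0" for m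
      proof (cases "m = n")
        case False
        have "H (of_real (lam m)) = (\<integral>t. F (of_real (lam n * t)) * F (of_real (lam m * t)) \<partial>M)"
          by (simp add: H_def dilation_integral_def g_def l_def mult.commute)
        then show ?thesis using orth[of n m] False by (simp add: N_def)
      qed (simp add: N_def l_def)
      show "cmod (N w) \<le> (C * (1 + (cmod l)\<^sup>2)) * (1 + (cmod w)\<^sup>2) * mean_modulus w" for w
      proof -
        have "cmod (w\<^sup>2 - l\<^sup>2) \<le> (cmod w)\<^sup>2 + (cmod l)\<^sup>2"
          using norm_triangle_ineq4[of "w\<^sup>2" "l\<^sup>2"] by (simp add: norm_power)
        also have "\<dots> \<le> (1 + (cmod l)\<^sup>2) * (1 + (cmod w)\<^sup>2)" by (simp add: algebra_simps)
        finally have "cmod (N w) \<le> ((1 + (cmod l)\<^sup>2) * (1 + (cmod w)\<^sup>2)) * (C * mean_modulus w)"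
          unfolding N_def norm_mult H_def mean_modulus_def
          by (intro mult_mono cmod_dilation_integral_le[OF holF contg C]) auto
        then show ?thesis by (simp add: mult_ac)
      qed
    qed
    define h where "h = Abs_fps (\<lambda>k. (\<integral>t. g t * of_real (t ^ k) \<partial>M) * ((deriv ^^ k) F 0 / fact k))"
    have h: "H has_fps_expansion h" unfolding H_def h_def by (rule dilation_integral_fps[OF holF contg])
    define p where "p = fps_expansion F 0"
    have p: "F has_fps_expansion p" unfolding p_def
      by (rule analytic_at_imp_has_fps_expansion_0) (use holF in \<open>auto intro: holomorphic_on_imp_analytic_at\<close>)
    have "N has_fps_expansion (fps_X\<^sup>2 - fps_const (l\<^sup>2)) * h"
      unfolding N_def by (intro fps_expansion_intros h)
    moreover have "(\<lambda>w. N 0 * F w) has_fps_expansion fps_const (N 0) * p"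
      by (intro fps_expansion_intros p)
    moreover have "(\<lambda>w. N 0 * F w) = N" by (rule ext, rule N_eq[symmetric])
    ultimately have "(fps_X\<^sup>2 - fps_const (l\<^sup>2)) * h = fps_const (N 0) * p"
      using fps_expansion_unique_complex by metis
    then have nth2: "fps_nth ((fps_X\<^sup>2 - fps_const (l\<^sup>2)) * h) 2 = N 0 * fps_nth p 2" by simp
    have coeff: "fps_nth h 0 - l\<^sup>2 * fps_nth h 2 = N 0 * (a / 2)"
    proof -
      have "fps_nth (fps_X\<^sup>2 * h) 2 = fps_nth h 0" by (subst fps_X_power_mult_nth) simp
      moreover have "fps_nth p 2 = a / 2" by (simp add: p_def fps_expansion_def a_def numeral_2_eq_2)
      ultimately show ?thesis using nth2 by (simp only: left_diff_distrib fps_sub_nth fps_mult_left_const_nth)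
    qed
    have h0: "fps_nth h 0 = I l" "H 0 = I l" "fps_nth h 2 = J l * (a / 2)"
      by (simp_all add: h_def H_def I_def J_def dilation_integral_def g_def F_0 a_def numeral_2_eq_2 mult.commute)
    have "N 0 = - l\<^sup>2 * I l" by (simp add: N_def h0)
    with coeff have "I l - l\<^sup>2 * (J l * (a / 2)) = - l\<^sup>2 * I l * (a / 2)" by (simp add: h0)
    then show ?thesis unfolding l_def[symmetric] by (simp add: field_simps)
  qed
  define K where "K w = (a * w\<^sup>2 + 2) * I w - a * w\<^sup>2 * J w" for w
  have holI: "I holomorphic_on UNIV" "J holomorphic_on UNIV"
    unfolding I_def J_def by (intro dilation_integral_holomorphic holF continuous_on_const cont_sq)+
  have "K z = K 0 * F z"
  proof (rule multiple_of_F_if_vanishes_at_zeros[OF inj])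
    show "K holomorphic_on UNIV" unfolding K_def by (intro holomorphic_intros holI)
    have "I (- w) = I w" "J (- w) = J w" for w
      unfolding I_def J_def by (rule dilation_integral_even, rule F_even)+
    then show "K (- w) = K w" for w by (simp add: K_def)
    show "K (of_real (lam n)) = 0" for n using at_zero[of n] by (simp add: K_def)
    show "cmod (K w) \<le> (2 + 2 * cmod a) * (1 + (cmod w)\<^sup>2) * mean_modulus w" for w
    proof -
      have I: "cmod (I w) \<le> 1 * mean_modulus w" unfolding I_def mean_modulus_def
        by (rule cmod_dilation_integral_le[OF holF continuous_on_const]) simp
      have J: "cmod (J w) \<le> 1 * mean_modulus w" unfolding J_def mean_modulus_def
        by (rule cmod_dilation_integral_le[OF holF cont_sq]) (simp add: norm_power power_le_one)
      have "cmod (a * w\<^sup>2 + 2) \<le> cmod a * (cmod w)\<^sup>2 + 2"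
        using norm_triangle_ineq[of "a * w\<^sup>2" 2] by (simp add: norm_mult norm_power)
      then have "cmod ((a * w\<^sup>2 + 2) * I w) \<le> (cmod a * (cmod w)\<^sup>2 + 2) * mean_modulus w"
        using I mean_modulus_nonneg[of w] unfolding norm_mult by (intro mult_mono) auto
      moreover have "cmod (a * w\<^sup>2 * J w) \<le> cmod a * (cmod w)\<^sup>2 * mean_modulus w"
        using J unfolding norm_mult norm_power by (intro mult_left_mono) auto
      ultimately have "cmod (K w) \<le> (cmod a * (cmod w)\<^sup>2 + 2) * mean_modulus w + cmod a * (cmod w)\<^sup>2 * mean_modulus w"
        unfolding K_def using norm_triangle_ineq4[of "(a * w\<^sup>2 + 2) * I w" "a * w\<^sup>2 * J w"] by linarith
      also have "\<dots> = (2 * cmod a * (cmod w)\<^sup>2 + 2) * mean_modulus w" by (simp add: algebra_simps)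
      also have "\<dots> \<le> (2 + 2 * cmod a) * (1 + (cmod w)\<^sup>2) * mean_modulus w"
        by (intro mult_right_mono mean_modulus_nonneg) (simp add: algebra_simps)
      finally show ?thesis .
    qed
  qed
  moreover have "K 0 = 2 * of_real (measure M (space M))"
    by (simp add: K_def I_def dilation_integral_def F_0 scaleR_conv_of_real)
  ultimately show ?thesis unfolding I_def[symmetric] J_def[symmetric] by (simp add: K_def algebra_simps)
qed

end

section \<open>The Beta weight and the growth condition\<close>

definition beta_weight :: "real \<Rightarrow> real \<Rightarrow> real \<Rightarrow> real" where
  "beta_weight \<mu> \<beta> t = t powr \<mu> * (1 - t) powr \<beta>"

text \<open>
  The interval is open because \<open>0 powr s = 0\<close> for every \<open>s\<close>, which is not the limit of the weight at an
  endpoint when the exponent there is not positive.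
\<close>
definition beta_measure :: "real \<Rightarrow> real \<Rightarrow> real measure" where
  "beta_measure \<mu> \<beta> = density (lebesgue_on {0<..<1}) (\<lambda>t. ennreal (beta_weight \<mu> \<beta> t))"

context
  fixes \<mu> \<beta> :: real
  assumes exponents: "\<mu> > -1" "\<beta> > -1"
begin

lemma beta_weight_nonneg: "0 \<le> beta_weight \<mu> \<beta> t"
  by (simp add: beta_weight_def)

lemma integrable_beta_weight: "integrable (lebesgue_on {0<..<1}) (beta_weight \<mu> \<beta>)"
  and integral_beta_weight: "integral\<^sup>L (lebesgue_on {0<..<1}) (beta_weight \<mu> \<beta>) = Beta (\<mu> + 1) (\<beta> + 1)"
proof -
  have B: "(beta_weight \<mu> \<beta> has_integral Beta (\<mu> + 1) (\<beta> + 1)) {0<..<1}"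
    using has_integral_Beta_real[of "\<mu> + 1" "\<beta> + 1"] exponents
    unfolding has_integral_Icc_iff_Ioo by (simp add: beta_weight_def[abs_def])
  then have "beta_weight \<mu> \<beta> absolutely_integrable_on {0<..<1}"
    by (intro nonnegative_absolutely_integrable_1) (auto simp: beta_weight_nonneg has_integral_integrable)
  then show int: "integrable (lebesgue_on {0<..<1}) (beta_weight \<mu> \<beta>)"
    by (simp add: integrable_restrict_space set_integrable_def)
  from has_integral_integral_lebesgue_on[OF this] B
  show "integral\<^sup>L (lebesgue_on {0<..<1}) (beta_weight \<mu> \<beta>) = Beta (\<mu> + 1) (\<beta> + 1)"
    using has_integral_unique by (metis lmeasurable_interval(2) fmeasurableD box_real(1))
qed

lemma emeasure_beta_measure:
  "emeasure (beta_measure \<mu> \<beta>) (space (beta_measure \<mu> \<beta>)) = ennreal (Beta (\<mu> + 1) (\<beta> + 1))"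
proof -
  have "emeasure (beta_measure \<mu> \<beta>) (space (beta_measure \<mu> \<beta>))
      = (\<integral>\<^sup>+t. ennreal (beta_weight \<mu> \<beta> t) \<partial>lebesgue_on {0<..<1})"
    unfolding beta_measure_def
    using borel_measurable_integrable[OF integrable_beta_weight]
    by (subst emeasure_density) (auto intro!: nn_integral_cong simp: indicator_def)
  also have "\<dots> = ennreal (Beta (\<mu> + 1) (\<beta> + 1))"
    using nn_integral_eq_integral[OF integrable_beta_weight] by (simp add: beta_weight_nonneg integral_beta_weight)
  finally show ?thesis .
qed

lemma Beta_pos: "Beta (\<mu> + 1) (\<beta> + 1) > 0"
  unfolding Beta_def using exponents by (intro divide_pos_pos mult_pos_pos Gamma_real_pos) auto

lemma measure_beta_measure:
  "measure (beta_measure \<mu> \<beta>) (space (beta_measure \<mu> \<beta>)) = Beta (\<mu> + 1) (\<beta> + 1)"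
  unfolding measure_def emeasure_beta_measure using Beta_pos by simp

lemma diffuse_beta_measure: "diffuse_unit_measure (beta_measure \<mu> \<beta>)"
proof (intro diffuse_unit_measure.intro diffuse_unit_measure_axioms.intro finite_measureI)
  show "emeasure (beta_measure \<mu> \<beta>) (space (beta_measure \<mu> \<beta>)) \<noteq> \<infinity>"
    by (simp add: emeasure_beta_measure)
  have "id \<in> borel_measurable (lebesgue_on {0<..<1 :: real})" by (rule id_borel_measurable_lebesgue_on)
  then show "(\<lambda>t. t) \<in> borel_measurable (beta_measure \<mu> \<beta>)"
    by (simp add: beta_measure_def id_def)
  show "0 \<le> t \<and> t \<le> 1" if "t \<in> space (beta_measure \<mu> \<beta>)" for t
    using that by (auto simp: beta_measure_def)
  show "AE t in beta_measure \<mu> \<beta>. t \<noteq> x" for x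
  proof -
    have "AE t in lebesgue. t \<noteq> x" by (intro AE_completion AE_lborel_singleton)
    then have "AE t in lebesgue_on {0<..<1}. t \<noteq> x"
      by (subst AE_restrict_space_iff) auto
    moreover have "(\<lambda>t. ennreal (beta_weight \<mu> \<beta> t)) \<in> borel_measurable (lebesgue_on {0<..<1})"
      using borel_measurable_integrable[OF integrable_beta_weight] by simp
    ultimately show ?thesis
      unfolding beta_measure_def by (subst AE_density) auto
  qed
qed

lemma has_integral_beta_weight:
  fixes g :: "real \<Rightarrow> complex"
  assumes "continuous_on UNIV g"
  shows "((\<lambda>t. g t * of_real (beta_weight \<mu> \<beta> t)) has_integral (\<integral>t. g t \<partial>beta_measure \<mu> \<beta>)) {0..1}"
proof -
  interpret diffuse_unit_measure "beta_measure \<mu> \<beta>" by (rule diffuse_beta_measure)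
  have w: "beta_weight \<mu> \<beta> \<in> borel_measurable (lebesgue_on {0<..<1})"
    using borel_measurable_integrable[OF integrable_beta_weight] .
  have int: "integrable (beta_measure \<mu> \<beta>) g" by (rule integrable_continuous[OF assms])
  have g: "g \<in> borel_measurable (lebesgue_on {0<..<1})"
    using borel_measurable_integrable[OF int] by (simp add: beta_measure_def)
  have nn: "AE t in lebesgue_on {0<..<1}. 0 \<le> beta_weight \<mu> \<beta> t" by (simp add: beta_weight_nonneg)
  have "integrable (lebesgue_on {0<..<1}) (\<lambda>t. beta_weight \<mu> \<beta> t *\<^sub>R g t)"
    using int unfolding beta_measure_def by (subst (asm) integrable_density[OF g w nn])
  from has_integral_integral_lebesgue_on[OF this]
  show ?thesis
    unfolding has_integral_Icc_iff_Ioo beta_measure_def integral_density[OF g w nn]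
    by (simp add: scaleR_conv_of_real mult.commute)
qed

end

text \<open>
  Both alternatives bound \<open>ln (max_modulus F r)\<close> by \<open>\<epsilon> r\<^sup>2\<close> for large \<open>r\<close>, as long as that logarithm is
  positive; otherwise \<open>|F| \<le> 1\<close> on the circle.
\<close>
lemma class_A_minimal_type2:
  assumes hol: "F holomorphic_on UNIV"
    and growth: "growth_order F < 2 \<or> growth_order F = 2 \<and> growth_type 2 F = 0"
  shows "minimal_type2 F"
  unfolding minimal_type2_def
proof (intro allI impI)
  fix \<epsilon> :: real assume "\<epsilon> > 0"
  have le_max: "cmod (F z) \<le> max_modulus F (cmod z)" for z
    unfolding max_modulus_def
  proof (rule cSUP_upper)
    have "compact ((\<lambda>z. cmod (F z)) ` sphere 0 (cmod z))"
      using hol by (intro compact_continuous_image continuous_on_norm holomorphic_on_imp_continuous_on)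
        (auto intro: holomorphic_on_subset)
    then show "bdd_above ((\<lambda>z. cmod (F z)) ` sphere 0 (cmod z))"
      by (intro bounded_imp_bdd_above compact_imp_bounded)
  qed simp
  have "\<forall>\<^sub>F r in at_top. max_modulus F r > 1 \<longrightarrow> ln (max_modulus F r) \<le> \<epsilon> * r\<^sup>2"
    using growth
  proof
    assume "growth_order F < 2"
    then obtain \<rho>' where \<rho>': "growth_order F < \<rho>'" "\<rho>' < 2" using dense by blast
    then obtain \<rho> where \<rho>: "\<rho>' = ereal \<rho>" by (cases \<rho>') auto
    have "\<rho> < 2" using \<rho>'(2) unfolding \<rho> by simp
    have "\<forall>\<^sub>F r in at_top. ereal (ln (ln (max_modulus F r)) / ln r) < ereal \<rho>"
      using \<rho>'(1) unfolding growth_order_def \<rho> by (rule Limsup_lessD)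
    moreover have "\<forall>\<^sub>F r in at_top. r powr \<rho> \<le> \<epsilon> * r\<^sup>2"
    proof -
      have "((\<lambda>r::real. r powr (\<rho> - 2)) \<longlongrightarrow> 0) at_top"
        using \<open>\<rho> < 2\<close> by (intro tendsto_neg_powr filterlim_ident) auto
      then have "\<forall>\<^sub>F r in at_top. r powr (\<rho> - 2) < \<epsilon>" using \<open>\<epsilon> > 0\<close> by (rule order_tendstoD)
      then show ?thesis using eventually_gt_at_top[of 0]
      proof eventually_elim
        case (elim r)
        have "r powr \<rho> = r powr (\<rho> - 2) * r powr 2" by (simp flip: powr_add)
        also have "r powr 2 = r\<^sup>2" using elim by (simp add: powr_numeral)
        also have "r powr (\<rho> - 2) * r\<^sup>2 \<le> \<epsilon> * r\<^sup>2" using elim by (intro mult_right_mono) auto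
        finally show ?case .
      qed
    qed
    ultimately show ?thesis using eventually_gt_at_top[of 1]
    proof eventually_elim
      case (elim r)
      show ?case
      proof
        assume "max_modulus F r > 1"
        then have pos: "ln (max_modulus F r) > 0" by simp
        have "ln (ln (max_modulus F r)) < \<rho> * ln r" using elim by (simp add: divide_less_eq)
        then have "exp (ln (ln (max_modulus F r))) < exp (\<rho> * ln r)" by simp
        then have "ln (max_modulus F r) < r powr \<rho>" using pos elim by (simp add: powr_def)
        with elim show "ln (max_modulus F r) \<le> \<epsilon> * r\<^sup>2" by linarith
      qed
    qed
  next
    assume "growth_order F = 2 \<and> growth_type 2 F = 0"
    then have "growth_type 2 F < ereal \<epsilon>" using \<open>\<epsilon> > 0\<close> by simp
    then have "\<forall>\<^sub>F r in at_top. ereal (ln (max_modulus F r) / r powr 2) < ereal \<epsilon>"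
      unfolding growth_type_def by (rule Limsup_lessD)
    then show ?thesis using eventually_gt_at_top[of 0]
      by eventually_elim (auto simp: divide_less_eq powr_numeral)
  qed
  then show "\<forall>\<^sub>F r in at_top. \<forall>z. cmod z = r \<longrightarrow> cmod (F z) \<le> exp (\<epsilon> * r\<^sup>2)"
  proof eventually_elim
    case (elim r)
    show ?case
    proof (intro allI impI)
      fix z assume z: "cmod z = r"
      show "cmod (F z) \<le> exp (\<epsilon> * r\<^sup>2)"
      proof (cases "max_modulus F r > 1")
        case True
        with elim have "exp (ln (max_modulus F r)) \<le> exp (\<epsilon> * r\<^sup>2)" unfolding exp_le_cancel_iff by blast
        then show ?thesis using le_max[of z] z True by simp
      next
        case False
        then have "cmod (F z) \<le> 1" using le_max[of z] z by simp
        also have "1 \<le> exp (\<epsilon> * r\<^sup>2)" using \<open>\<epsilon> > 0\<close> by simp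
        finally show ?thesis .
      qed
    qed
  qed
qed

lemma branch_pow_add: "branch_pow L (s + t) z = branch_pow L s z * branch_pow L t z"
  by (simp add: branch_pow_def distrib_right exp_add)

lemma branch_pow_nonzero: "branch_pow L s z \<noteq> 0"
  by (simp add: branch_pow_def)

lemma branch_pow_1: "log_branch L \<Longrightarrow> z \<noteq> 0 \<Longrightarrow> branch_pow L 1 z = z"
  by (simp add: branch_pow_def log_branch_def)

section \<open>The theorem for the class A\<close>

theorem theorem3:
  fixes \<nu> \<alpha> \<beta> :: real
    and L f F :: "complex \<Rightarrow> complex"
    and lam :: "nat \<Rightarrow> real"
    and a A z :: complex
  assumes "\<alpha> > -1 - 2 * \<nu>" and "\<beta> > -1"
    and "log_branch L"
    and "class_A L \<nu> \<alpha> f F lam"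
    and "\<And>n m. n \<noteq> m \<Longrightarrow>
      integral {0..1} (\<lambda>t::real. f (of_real (lam n * t)) * f (of_real (lam m * t)) *
        of_real (t powr \<alpha> * (1 - t) powr \<beta>)) = 0"
    and "a = deriv (deriv F) 0"
    and "A = of_real (- 2 * Beta (2 * \<nu> + \<alpha> + 1) (\<beta> + 1))"
    and "z \<noteq> 0"
  shows "a * contour_integral (linepath 0 z)
             (\<lambda>u. branch_pow L (\<nu> + \<alpha> + 2) u * branch_pow L \<beta> (z - u) * f u)
       = (a * z\<^sup>2 + 2) * contour_integral (linepath 0 z)
             (\<lambda>u. branch_pow L (\<nu> + \<alpha>) u * branch_pow L \<beta> (z - u) * f u)
         + branch_pow L (\<nu> + \<alpha> + \<beta> + 1) z * f z * A"
proof -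
  define \<mu> where "\<mu> = 2 * \<nu> + \<alpha>"
  have \<mu>: "\<mu> > -1" using assms(1) by (simp add: \<mu>_def)
  note exponents = \<mu> \<open>\<beta> > -1\<close>
  note L = \<open>log_branch L\<close>
  from assms(4) have f: "\<And>z. z \<noteq> 0 \<Longrightarrow> f z = branch_pow L \<nu> z * F z"
    and holF: "F holomorphic_on UNIV" and even: "\<And>z. F (- z) = F z" and F0: "F 0 = 1"
    and growth: "growth_order F < 2 \<or> growth_order F = 2 \<and> growth_type 2 F = 0"
    and pos: "\<And>n. lam n > 0" and zeros: "{z. F z = 0} = (\<Union>n. {of_real (lam n), - of_real (lam n)})"
    and mult: "\<And>n. zorder F (of_real (lam n)) = int (card {m. lam m = lam n})"
    and summ: "summable (\<lambda>n. 1 / (lam n)\<^sup>2)"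
    unfolding class_A_def by blast+
  define M where "M = beta_measure \<mu> \<beta>"
  interpret diffuse_unit_measure M unfolding M_def by (rule diffuse_beta_measure[OF exponents])
  interpret canonical_even_product M F lam
    by unfold_locales
      (use holF pos summ zeros mult hadamard_even_minimal_type2[OF pos summ holF even F0 zeros mult
         class_A_minimal_type2[OF holF growth]] in auto)
  have contF: "continuous_on UNIV (\<lambda>t::real. F (of_real t * w))" for w
    by (rule continuous_on_entire_dilation[OF holF])
  have f_scale: "f (of_real t * w) = of_real (t powr \<nu>) * branch_pow L \<nu> w * F (of_real t * w)"
    if "0 < t" "w \<noteq> 0" for t w
    using that branch_pow_scale[OF L that(2,1)] by (simp add: f)
  \<comment> \<open>The branch contributes constants that do not vanish; \<open>f 0\<close> is unspecified, so both endpoints are left out.\<close>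
  have orth: "(\<integral>t. F (of_real (lam n * t)) * F (of_real (lam m * t)) \<partial>M) = 0" if "n \<noteq> m" for n m
  proof -
    define k where "k = branch_pow L \<nu> (of_real (lam n)) * branch_pow L \<nu> (of_real (lam m))"
    have "continuous_on UNIV (\<lambda>t::real. F (of_real (lam n * t)) * F (of_real (lam m * t)))"
      using contF[of "of_real (lam n)"] contF[of "of_real (lam m)"]
      by (simp add: mult.commute continuous_on_mult)
    from has_integral_mult_right[OF has_integral_beta_weight[OF exponents this], of k]
    have "((\<lambda>t. f (of_real (lam n * t)) * f (of_real (lam m * t)) * of_real (t powr \<alpha> * (1 - t) powr \<beta>))
      has_integral k * (\<integral>t. F (of_real (lam n * t)) * F (of_real (lam m * t)) \<partial>M)) {0..1}"
      unfolding M_def[symmetric]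
    proof (rule has_integral_spike_finite[rotated 2])
      fix t :: real assume "t \<in> {0..1} - {0, 1}"
      then have t: "0 < t" by auto
      have "t powr \<mu> = t powr \<nu> * t powr \<nu> * t powr \<alpha>" by (simp add: \<mu>_def flip: powr_add)
      then show "f (of_real (lam n * t)) * f (of_real (lam m * t)) * of_real (t powr \<alpha> * (1 - t) powr \<beta>)
        = k * (F (of_real (lam n * t)) * F (of_real (lam m * t)) * of_real (beta_weight \<mu> \<beta> t))"
        using f_scale[OF t, of "of_real (lam n)"] f_scale[OF t, of "of_real (lam m)"] pos[of n] pos[of m]
        by (simp add: k_def beta_weight_def mult_ac)
    qed simp
    then have "k * (\<integral>t. F (of_real (lam n * t)) * F (of_real (lam m * t)) \<partial>M) = 0"
      using assms(5)[OF that] by (simp add: integral_unique)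
    then show ?thesis by (simp add: k_def branch_pow_nonzero)
  qed
  define c where "c = z * branch_pow L (\<nu> + \<alpha>) z * branch_pow L \<beta> z * branch_pow L \<nu> z"
  \<comment> \<open>Both contour integrals at once: \<open>k = 2\<close> on the left of the equation and \<open>k = 0\<close> on the right.\<close>
  have contour: "contour_integral (linepath 0 z) (\<lambda>u. branch_pow L (\<nu> + \<alpha> + real k) u * branch_pow L \<beta> (z - u) * f u)
    = c * branch_pow L (real k) z * dilation_integral (\<lambda>t. of_real (t ^ k)) F z" for k
  proof (rule contour_integral_unique, unfold has_contour_integral_linepath)
    have "continuous_on UNIV (\<lambda>t. of_real (t ^ k) * F (of_real t * z))"
      by (intro continuous_on_mult contF) (intro continuous_intros)
    from has_integral_mult_right[OF has_integral_beta_weight[OF exponents this], of "c * branch_pow L (real k) z"]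
    show "((\<lambda>x. branch_pow L (\<nu> + \<alpha> + real k) (linepath 0 z x) * branch_pow L \<beta> (z - linepath 0 z x) *
        f (linepath 0 z x) * (z - 0)) has_integral
        c * branch_pow L (real k) z * dilation_integral (\<lambda>t. of_real (t ^ k)) F z) {0..1}"
      unfolding M_def[symmetric] dilation_integral_def
    proof (rule has_integral_spike_finite[rotated 2])
      fix t :: real assume "t \<in> {0..1} - {0, 1}"
      then have t: "0 < t" "0 < 1 - t" by auto
      have lin: "linepath 0 z t = of_real t * z" "z - linepath 0 z t = of_real (1 - t) * z"
        by (simp_all add: linepath_def scaleR_conv_of_real algebra_simps)
      have "t powr (\<nu> + \<alpha> + real k) * t powr \<nu> = t powr \<mu> * t ^ k"
        using t by (simp add: \<mu>_def powr_realpow[symmetric] flip: powr_add) (simp add: algebra_simps)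
      then have pw: "complex_of_real (t powr (\<nu> + \<alpha> + real k)) * of_real (t powr \<nu>) = of_real (t powr \<mu>) * of_real (t ^ k)"
        by (metis of_real_mult)
      show "branch_pow L (\<nu> + \<alpha> + real k) (linepath 0 z t) * branch_pow L \<beta> (z - linepath 0 z t) *
          f (linepath 0 z t) * (z - 0)
        = c * branch_pow L (real k) z * (of_real (t ^ k) * F (of_real t * z) * of_real (beta_weight \<mu> \<beta> t))"
      proof -
        have "branch_pow L (\<nu> + \<alpha> + real k) (of_real t * z) * branch_pow L \<beta> (of_real (1 - t) * z) * f (of_real t * z) * z
          = (complex_of_real (t powr (\<nu> + \<alpha> + real k)) * of_real (t powr \<nu>)) * of_real ((1 - t) powr \<beta>) *
            (branch_pow L (\<nu> + \<alpha>) z * branch_pow L (real k) z * branch_pow L \<beta> z * branch_pow L \<nu> z * z * F (of_real t * z))"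
          unfolding branch_pow_scale[OF L \<open>z \<noteq> 0\<close> t(1)] branch_pow_scale[OF L \<open>z \<noteq> 0\<close> t(2)]
            f_scale[OF t(1) \<open>z \<noteq> 0\<close>] branch_pow_add[of L "\<nu> + \<alpha>"] by (simp only: mult_ac)
        then show ?thesis unfolding lin(2) unfolding lin(1) pw diff_zero c_def beta_weight_def of_real_mult by (simp only: mult_ac)
      qed
    qed simp
  qed
  have pow: "branch_pow L (real 0) z = 1" "branch_pow L (real 2) z = z\<^sup>2"
    using branch_pow_add[of L 1 1 z] branch_pow_1[OF L \<open>z \<noteq> 0\<close>]
    by (simp_all add: branch_pow_def power2_eq_square)
  have eq: "a * z\<^sup>2 * dilation_integral (\<lambda>t. of_real (t ^ 2)) F z
     = (a * z\<^sup>2 + 2) * dilation_integral (\<lambda>t. 1) F z - 2 * of_real (Beta (\<mu> + 1) (\<beta> + 1)) * F z"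
    using dilation_equation[OF _ orth, of z] Beta_pos[OF exponents]
    unfolding M_def measure_beta_measure[OF exponents] assms(6) by auto
  have last: "branch_pow L (\<nu> + \<alpha> + \<beta> + 1) z * f z = c * F z"
    unfolding branch_pow_add[of L _ 1] branch_pow_add[of L _ \<beta>] branch_pow_1[OF L \<open>z \<noteq> 0\<close>] f[OF \<open>z \<noteq> 0\<close>] c_def
    by (simp only: mult_ac)
  have A: "A = - 2 * of_real (Beta (\<mu> + 1) (\<beta> + 1))" by (simp add: assms(7) \<mu>_def)
  have "a * (c * z\<^sup>2 * dilation_integral (\<lambda>t. of_real (t ^ 2)) F z)
     = c * (a * z\<^sup>2 * dilation_integral (\<lambda>t. of_real (t ^ 2)) F z)" by simp
  also have "\<dots> = (a * z\<^sup>2 + 2) * (c * 1 * dilation_integral (\<lambda>t. of_real (t ^ 0)) F z) + c * F z * A"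
    unfolding eq A by (simp add: algebra_simps)
  finally show ?thesis
    using contour[of 0] contour[of 2] unfolding last pow by simp
qed

end
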